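(* There exists a constant $c > 0$ such that for every integer $t \geq 3$, \[\tilde{r}(t) \leq t^{-c \frac{\log t}{\log \log t}} 4^t.\]
   Context: The on-line Ramsey number $\tilde{r}(G)$ of a graph $G$ is defined via the following game between Builder and Painter, played on an initially edgeless graph with an unlimited supply of vertices: in each round Builder draws a new edge, and Painter immediately colours it red or blue. Builder wins once the coloured graph contains a monochromatic copy of $G$. $\tilde{r}(G)$ is the minimum number of edges Builder must draw to guarantee a win, regardless of Painter's strategy. We write $\tilde{r}(t) = \tilde{r}(K_t)$. Here $\log$ is the natural logarithm. *)

theory Defs
  imports Complex_Main "HOL-Library.Ramsey"
begin

text \<open>A simple graph is a pair (vertices, edges) whose edges are 2-element sets of vertices.\<close>

type_synonym 'a graph = "'a set \<times> 'a set set"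

definition simple_graph :: "'a graph \<Rightarrow> bool" where
  "simple_graph G \<longleftrightarrow> snd G \<subseteq> [fst G]\<^bsup>2\<^esup>"

definition complete_graph :: "nat \<Rightarrow> nat graph" where
  "complete_graph t = ({..<t}, [{..<t}]\<^bsup>2\<^esup>)"

text \<open>The board has vertex set \<open>nat\<close>; a position is the pair of sets of red and of blue edges drawn
  so far. A copy is a not necessarily induced subgraph.\<close>

definition contains_copy :: "nat set set \<Rightarrow> 'a graph \<Rightarrow> bool" where
  "contains_copy C G \<longleftrightarrow> (\<exists>f. inj_on f (fst G) \<and> (\<forall>e\<in>snd G. f ` e \<in> C))"

definition mono_copy :: "'a graph \<Rightarrow> nat set set \<Rightarrow> nat set set \<Rightarrow> bool" where
  "mono_copy G R B \<longleftrightarrow> contains_copy R G \<or> contains_copy B G"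

text \<open>\<open>builder_wins G n R B\<close>: from the position \<open>(R, B)\<close> Builder can force a monochromatic
  copy of \<open>G\<close> within \<open>n\<close> further rounds.\<close>

primrec builder_wins :: "'a graph \<Rightarrow> nat \<Rightarrow> nat set set \<Rightarrow> nat set set \<Rightarrow> bool" where
  "builder_wins G 0 R B \<longleftrightarrow> mono_copy G R B"
| "builder_wins G (Suc n) R B \<longleftrightarrow> mono_copy G R B \<or>
     (\<exists>e\<in>[UNIV]\<^bsup>2\<^esup>. e \<notin> R \<union> B \<and>
        builder_wins G n (insert e R) B \<and> builder_wins G n R (insert e B))"

definition online_ramsey :: "'a graph \<Rightarrow> nat" where
  "online_ramsey G = (LEAST n. builder_wins G n {} {})"

text \<open>By Ramsey's theorem the minimum is over a nonempty set for every finite simple graph.\<close>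

lemma builder_wins_by_drawing_all:
  assumes "finite S" "S \<subseteq> [UNIV]\<^bsup>2\<^esup>" "S \<inter> (R \<union> B) = {}"
    and "\<And>X Y. X \<union> Y = S \<Longrightarrow> mono_copy G (X \<union> R) (Y \<union> B)"
  shows "builder_wins G (card S) R B"
  using assms
proof (induction S arbitrary: R B rule: finite_induct)
  case empty
  then show ?case using empty.prems(3)[of "{}" "{}"] by simp
next
  case (insert e S)
  have "builder_wins G (card S) (insert e R) B"
  proof (rule insert.IH)
    fix X Y assume "X \<union> Y = S"
    then show "mono_copy G (X \<union> insert e R) (Y \<union> B)"
      using insert.prems(3)[of "insert e X" Y] by simp
  qed (use insert.hyps insert.prems(1,2) in auto)
  moreover have "builder_wins G (card S) R (insert e B)"
  proof (rule insert.IH)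
    fix X Y assume "X \<union> Y = S"
    then show "mono_copy G (X \<union> R) (Y \<union> insert e B)"
      using insert.prems(3)[of X "insert e Y"] by simp
  qed (use insert.hyps insert.prems(1,2) in auto)
  moreover have "e \<in> [UNIV]\<^bsup>2\<^esup>" "e \<notin> R \<union> B"
    using insert.prems(1,2) by auto
  ultimately show ?case
    unfolding card_insert_disjoint[OF insert.hyps(1,2)] builder_wins.simps by blast
qed

lemma contains_copy_if_clique:
  assumes "simple_graph G" "finite (fst G)" "finite K" "card K = card (fst G)" "clique K C"
  shows "contains_copy C G"
proof -
  obtain f where f: "bij_betw f (fst G) K"
    using assms finite_same_card_bij by metis
  have "f ` e \<in> C" if e: "e \<in> snd G" for e
  proof -
    obtain u v where "e = {u, v}" "u \<in> fst G" "v \<in> fst G" "u \<noteq> v"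
      using e assms(1) by (fastforce simp: simple_graph_def nsets_2_eq)
    then show ?thesis
      using f assms(5) by (auto simp: bij_betw_def clique_def inj_on_def)
  qed
  then show ?thesis
    using f by (auto simp: contains_copy_def bij_betw_def)
qed

lemma ex_builder_wins:
  assumes "simple_graph G" "finite (fst G)"
  shows "\<exists>n. builder_wins G n {} {}"
proof -
  let ?m = "card (fst G)"
  obtain r where r: "\<forall>(V :: nat set) E. finite V \<and> card V \<ge> r \<longrightarrow>
      (\<exists>K\<subseteq>V. card K = ?m \<and> clique K E \<or> card K = ?m \<and> indep K E)"
    using ramsey2[of ?m ?m] by (elim exE conjE) (rule that)
  have "builder_wins G (card ([{..<r}]\<^bsup>2\<^esup>)) {} {}"
  proof (rule builder_wins_by_drawing_all)
    fix X Y assume XY: "X \<union> Y = [{..<r}]\<^bsup>2\<^esup>"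
    obtain K where K: "K \<subseteq> {..<r}" "card K = ?m" "clique K X \<or> indep K X"
      using r[rule_format, of "{..<r}" X] by auto
    have "clique K Y" if "indep K X"
      unfolding clique_def
    proof (intro ballI impI)
      fix v w assume vw: "v \<in> K" "w \<in> K" "v \<noteq> w"
      then have "{v, w} \<in> X \<union> Y"
        using K(1) unfolding XY nsets_2_eq by blast
      then show "{v, w} \<in> Y" using that vw by (auto simp: indep_def)
    qed
    moreover have "finite K" using K(1) finite_subset by blast
    ultimately show "mono_copy G (X \<union> {}) (Y \<union> {})"
      using K(2,3) contains_copy_if_clique[OF assms] unfolding mono_copy_def Un_empty_right by blast
  qed (simp_all add: finite_imp_finite_nsets nsets_mono)
  then show ?thesis by blast
qed

end

theory Submission
  imports Defs "HOL-Real_Asymp.Real_Asymp"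
begin

text \<open>Builder first plays \<open>t\<close> steps of the Erdos-Szekeres argument: she joins a vertex to the whole current
  set and keeps the larger colour class. Starting from \<open>2 ^ t * N\<close> vertices this takes fewer than
  \<open>2 ^ (t + 1) * N\<close> edges and leaves \<open>N\<close> vertices on which cliques of sizes \<open>k\<close> and \<open>l\<close> with \<open>k + l = t\<close>
  suffice; then she draws all edges between these. So it is enough to have a Ramsey bound
  \<open>R(k, l) \<le> 2 ^ (k + l) * exp (- ((k + l) powr (1/4)))\<close> for large \<open>k + l\<close>.

  Away from the diagonal this follows from a weighted Erdos-Szekeres bound. Near the diagonal, either
  some vertex repeatedly has an atypically large degree in one colour, which already wins enough, or all degrees
  are close to one half and the book algorithm of Balister, Bollobas, Campos, Griffiths, Hurley, Morris,
  Sahasrabudhe and Tiba produces a monochromatic clique of size about \<open>(k + l) powr (2/3)\<close> with a common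
  neighbourhood almost as large as in a random colouring. Passing to that neighbourhood moves the
  problem off the diagonal.\<close>

section \<open>Correlated pairs for Gram kernels\<close>

text \<open>The entire function cosh (sqrt x), which continues to x < 0 as cos (sqrt (- x)). It
  combines nonnegative Taylor coefficients, boundedness for x < 0 and growth of only exp (sqrt x)
  for x > 0.\<close>

definition cosh_sqrt :: "real \<Rightarrow> real" where
  "cosh_sqrt x = (\<Sum>n. x ^ n / fact (2 * n))"

lemma cosh_sqrt_sums: "(\<lambda>n. x ^ n / fact (2 * n)) sums cosh_sqrt x"
proof -
  have "summable (\<lambda>n. x ^ n / fact (2 * n))"
  proof (rule summable_comparison_test')
    show "summable (\<lambda>n. \<bar>x\<bar> ^ n / fact n)"
      using summable_exp[of "\<bar>x\<bar>"] by (simp add: field_simps)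
    show "norm (x ^ n / fact (2 * n)) \<le> \<bar>x\<bar> ^ n / fact n" if "n \<ge> 0" for n
      by (simp add: power_abs frac_le fact_mono)
  qed
  then show ?thesis
    unfolding cosh_sqrt_def by (rule summable_sums)
qed

lemma sums_even_reindex:
  fixes f :: "nat \<Rightarrow> real"
  assumes "f sums c" "\<And>n. odd n \<Longrightarrow> f n = 0"
  shows "(\<lambda>n. f (2 * n)) sums c"
proof -
  have "strict_mono (\<lambda>n::nat. 2 * n)"
    by (simp add: strict_mono_def)
  moreover have "f n = 0" if "n \<notin> range (\<lambda>n. 2 * n)" for n
    using that assms(2) by (auto elim!: evenE)
  ultimately show ?thesis
    using assms(1) sums_mono_reindex[of "\<lambda>n. 2 * n" f c] by simp
qed

lemma cosh_sqrt_nonneg: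
  assumes "x \<ge> 0"
  shows "cosh_sqrt x = cosh (sqrt x)"
proof -
  have "(\<lambda>n. sqrt x ^ (2 * n) /\<^sub>R fact (2 * n)) sums cosh (sqrt x)"
    using sums_even_reindex[OF cosh_converges[of "sqrt x"]] by simp
  moreover have "sqrt x ^ (2 * n) /\<^sub>R fact (2 * n) = x ^ n / fact (2 * n)" for n
    using assms by (simp add: power_mult divide_inverse)
  ultimately show ?thesis
    using cosh_sqrt_sums[of x] by (simp add: sums_unique2)
qed

lemma cosh_sqrt_nonpos: "x \<le> 0 \<Longrightarrow> cosh_sqrt x = cos (sqrt (- x))"
proof -
  assume "x \<le> 0"
  then have "cos_coeff (2 * n) *\<^sub>R sqrt (- x) ^ (2 * n) = x ^ n / fact (2 * n)" for n
    by (simp add: cos_coeff_def power_mult power_mult_distrib[symmetric])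
  moreover have "(\<lambda>n. cos_coeff (2 * n) *\<^sub>R sqrt (- x) ^ (2 * n)) sums cos (sqrt (- x))"
    using sums_even_reindex[OF cos_converges[of "sqrt (- x)"]] by (simp add: cos_coeff_def)
  ultimately show ?thesis
    using cosh_sqrt_sums[of x] by (simp add: sums_unique2)
qed

lemma cosh_sqrt_ge: "x \<ge> 0 \<Longrightarrow> 1 + x / 2 \<le> cosh_sqrt x"
proof -
  assume "x \<ge> 0"
  then have "(\<Sum>n<2. x ^ n / fact (2 * n)) \<le> cosh_sqrt x"
    using cosh_sqrt_sums[of x] by (intro sum_le_suminf[THEN order_trans])
      (auto simp: sums_iff)
  then show ?thesis by (simp add: numeral_2_eq_2)
qed

lemma cosh_sqrt_nonpos_bounds: "x \<le> 0 \<Longrightarrow> \<bar>cosh_sqrt x\<bar> \<le> 1"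
  by (simp add: cosh_sqrt_nonpos)

lemma cosh_le_exp: "(x::real) \<ge> 0 \<Longrightarrow> cosh x \<le> exp x"
  by (simp add: cosh_def)

lemma cosh_sqrt_le: 
  assumes "x \<le> M" "M \<ge> 0"
  shows "cosh_sqrt x \<le> exp (sqrt M)"
proof (cases "x \<ge> 0")
  case True
  then have "cosh_sqrt x \<le> exp (sqrt x)"
    by (simp add: cosh_sqrt_nonneg cosh_le_exp)
  also have "\<dots> \<le> exp (sqrt M)"
    using assms by simp
  finally show ?thesis .
next
  case False
  then have "cosh_sqrt x \<le> 1"
    using cosh_sqrt_nonpos_bounds[of x] by linarith
  also have "\<dots> \<le> exp (sqrt M)" using assms by simp
  finally show ?thesis .
qed

text \<open>The Taylor coefficients of \<open>moment_fun\<close> are nonnegative, so its sum over pairs is nonnegative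
  when its arguments are Gram kernels; but it is at most \<open>-1\<close> as soon as one argument is below
  \<open>-6\<close>, and it grows only like \<open>exp (2 * sqrt M)\<close>. Hence pairs with both kernels above \<open>-6\<close> and one of
  them at a large level \<open>n ^ 2\<close> cannot be rarer than about \<open>exp (- 4 * n)\<close>, for some \<open>n\<close>.\<close>

definition moment_fun :: "real \<Rightarrow> real \<Rightarrow> real" where
  "moment_fun x y = x * (2 + cosh_sqrt y) + y * (2 + cosh_sqrt x)"

lemma moment_fun_sym: "moment_fun x y = moment_fun y x"
  by (simp add: moment_fun_def)

text \<open>The threshold 6 balances the two summands: for y >= 0 the bound 2 + cosh (sqrt y) >= 3 +
  y / 2 makes the first at most - 18 - 3 * y, which absorbs the second, at most 3 * y. For y < 0 the
  first is at most x and the second at most 0.\<close>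

lemma moment_fun_neg_aux:
  assumes "x < - 6"
  shows "moment_fun x y \<le> - 1"
proof (cases "y \<ge> 0")
  case True
  have gx: "cosh_sqrt x \<le> 1"
    using cosh_sqrt_nonpos_bounds[of x] assms by linarith
  have "x * (2 + cosh_sqrt y) \<le> - 6 * (2 + cosh_sqrt y)"
    using assms True cosh_sqrt_ge[of y] by (intro mult_right_mono) auto
  moreover have "y * (2 + cosh_sqrt x) \<le> y * 3"
    using True gx by (intro mult_left_mono) auto
  ultimately show ?thesis
    using cosh_sqrt_ge[OF True] by (simp add: moment_fun_def)
next
  case False
  have g: "\<bar>cosh_sqrt x\<bar> \<le> 1" "\<bar>cosh_sqrt y\<bar> \<le> 1"
    using cosh_sqrt_nonpos_bounds assms False by auto
  have "x * (2 + cosh_sqrt y) \<le> x * 1"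
    using g assms by (intro mult_left_mono_neg) auto
  then have "x * (2 + cosh_sqrt y) \<le> x" by (simp only: mult_1_right)
  moreover have "y * (2 + cosh_sqrt x) \<le> 0"
    using g False by (intro mult_nonpos_nonneg) auto
  ultimately show ?thesis
    using assms unfolding moment_fun_def by linarith
qed

lemma moment_fun_neg: "x < - 6 \<or> y < - 6 \<Longrightarrow> moment_fun x y \<le> - 1"
  using moment_fun_neg_aux moment_fun_sym by metis

lemma moment_fun_le:
  assumes "x \<le> M" "y \<le> M" "M \<ge> 0"
  shows "moment_fun x y \<le> 12 * exp (2 * sqrt M)"
proof -
  define z where "z = exp (sqrt M)"
  have z: "z \<ge> 1" "M \<le> 2 * z"
  proof -
    show "z \<ge> 1" using assms by (simp add: z_def)
    \<comment> \<open>The quadratic Taylor term absorbs the polynomial factor \<open>M\<close> into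
      a second exponential, whence the 2 in exp (2 * sqrt M).\<close>
    have "1 + sqrt M + (sqrt M)\<^sup>2 / 2 \<le> z"
      unfolding z_def by (rule exp_lower_Taylor_quadratic) (use assms in simp)
    moreover have "sqrt M \<ge> 0" "(sqrt M)\<^sup>2 = M" using assms by auto
    ultimately show "M \<le> 2 * z" by linarith
  qed
  have aux: "u * (2 + cosh_sqrt v) \<le> M * (3 * z)" if "u \<le> M" "v \<le> M" for u v
  proof -
    have "0 \<le> 2 + cosh_sqrt v"
      using cosh_sqrt_ge[of v] cosh_sqrt_nonpos_bounds[of v] by (cases "v \<ge> 0") auto
    then have "u * (2 + cosh_sqrt v) \<le> M * (2 + cosh_sqrt v)"
      using that by (intro mult_right_mono) auto
    also have "\<dots> \<le> M * (3 * z)"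
    proof (rule mult_left_mono)
      show "2 + cosh_sqrt v \<le> 3 * z"
        using cosh_sqrt_le[OF that(2) assms(3)] z(1) by (fold z_def) linarith
    qed (rule assms(3))
    finally show ?thesis .
  qed
  have "moment_fun x y \<le> 2 * (M * (3 * z))"
    using aux[OF assms(1,2)] aux[OF assms(2,1)] by (simp add: moment_fun_def)
  also have "\<dots> \<le> 2 * (2 * z * (3 * z))"
    using z by (intro mult_left_mono mult_right_mono) auto
  also have "\<dots> = 12 * exp (2 * sqrt M)"
    by (simp add: z_def exp_double power2_eq_square)
  finally show ?thesis .
qed

section \<open>Positive semidefinite kernels and the moment sum\<close>

definition psd_on :: "'a set \<Rightarrow> ('a \<Rightarrow> 'a \<Rightarrow> real) \<Rightarrow> bool" where
  "psd_on X K \<longleftrightarrow> (\<forall>c. (\<Sum>x\<in>X. \<Sum>y\<in>X. c x * c y * K x y) \<ge> 0)"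

definition gram :: "'u set \<Rightarrow> ('a \<Rightarrow> 'u \<Rightarrow> real) \<Rightarrow> 'a \<Rightarrow> 'a \<Rightarrow> real" where
  "gram U s x y = (\<Sum>u\<in>U. s x u * s y u)"

lemma psd_on_const: "psd_on X (\<lambda>x y. 1)"
proof -
  have "(\<Sum>x\<in>X. \<Sum>y\<in>X. c x * c y * 1) = (\<Sum>x\<in>X. c x)\<^sup>2" for c :: "'a \<Rightarrow> real"
    by (simp add: power2_eq_square sum_product)
  then show ?thesis unfolding psd_on_def by simp
qed

text \<open>A case of the Schur product theorem: expanding \<open>gram\<close> over \<open>u\<close>
  turns the quadratic form into a sum of quadratic forms of \<open>K\<close> with coefficients
  \<open>c x * s x u\<close>.\<close>

lemma psd_on_gram_mult:
  assumes "psd_on X K"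
  shows "psd_on X (\<lambda>x y. gram U s x y * K x y)"
  unfolding psd_on_def
proof
  fix c :: "'a \<Rightarrow> real"
  have "(\<Sum>x\<in>X. \<Sum>y\<in>X. c x * c y * (gram U s x y * K x y))
      = (\<Sum>x\<in>X. \<Sum>y\<in>X. \<Sum>u\<in>U. (c x * s x u) * (c y * s y u) * K x y)"
    by (simp add: gram_def sum_distrib_left sum_distrib_right algebra_simps)
  also have "\<dots> = (\<Sum>x\<in>X. \<Sum>u\<in>U. \<Sum>y\<in>X. (c x * s x u) * (c y * s y u) * K x y)"
    by (intro sum.cong refl sum.swap)
  also have "\<dots> = (\<Sum>u\<in>U. \<Sum>x\<in>X. \<Sum>y\<in>X. (c x * s x u) * (c y * s y u) * K x y)"
    by (rule sum.swap)
  also have "\<dots> \<ge> 0"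
  proof (rule sum_nonneg)
    fix u
    show "(\<Sum>x\<in>X. \<Sum>y\<in>X. (c x * s x u) * (c y * s y u) * K x y) \<ge> 0"
      using assms[unfolded psd_on_def, rule_format, of "\<lambda>x. c x * s x u"] .
  qed
  finally show "(\<Sum>x\<in>X. \<Sum>y\<in>X. c x * c y * (gram U s x y * K x y)) \<ge> 0" .
qed

lemma psd_on_gram_power: "psd_on X (\<lambda>x y. gram U s x y ^ n)"
proof (induction n)
  case 0
  show ?case using psd_on_const by simp
next
  case (Suc n)
  then show ?case using psd_on_gram_mult by simp
qed

lemma psd_on_sum_nonneg: "psd_on X K \<Longrightarrow> (\<Sum>x\<in>X. \<Sum>y\<in>X. K x y) \<ge> 0"
  unfolding psd_on_def by (drule spec[of _ "\<lambda>_. 1"]) simp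

text \<open>Every term of the power series gives a positive multiple of a product of Gram kernels,
  so its sum over all pairs is nonnegative; the summand 2 contributes twice the sum of a Gram
  kernel.\<close>

lemma sum_gram_cosh_sqrt_nonneg:
  "(\<Sum>x\<in>X. \<Sum>y\<in>X. gram U s x y * (2 + cosh_sqrt (gram U' s' x y))) \<ge> 0"
proof -
  have lim: "(\<lambda>n. \<Sum>x\<in>X. \<Sum>y\<in>X. gram U s x y * (gram U' s' x y ^ n / fact (2 * n)))
      sums (\<Sum>x\<in>X. \<Sum>y\<in>X. gram U s x y * cosh_sqrt (gram U' s' x y))"
    by (intro sums_sum sums_mult cosh_sqrt_sums)
  have nonneg: "(\<Sum>x\<in>X. \<Sum>y\<in>X. gram U s x y * (gram U' s' x y ^ n / fact (2 * n))) \<ge> 0" for n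
  proof -
    have "(\<Sum>x\<in>X. \<Sum>y\<in>X. gram U s x y * (gram U' s' x y ^ n / fact (2 * n)))
       = (\<Sum>x\<in>X. \<Sum>y\<in>X. gram U s x y * gram U' s' x y ^ n) / fact (2 * n)"
      by (simp add: sum_divide_distrib)
    moreover have "(\<Sum>x\<in>X. \<Sum>y\<in>X. gram U s x y * gram U' s' x y ^ n) \<ge> 0"
      by (intro psd_on_sum_nonneg psd_on_gram_mult psd_on_gram_power)
    ultimately show ?thesis by simp
  qed
  have "(\<Sum>x\<in>X. \<Sum>y\<in>X. gram U s x y * cosh_sqrt (gram U' s' x y)) \<ge> 0"
    by (rule sums_le[OF nonneg sums_zero lim])
  moreover have "(\<Sum>x\<in>X. \<Sum>y\<in>X. gram U s x y) \<ge> 0"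
    using psd_on_sum_nonneg[OF psd_on_gram_power[of X U s 1]] by simp
  ultimately show ?thesis
    by (simp add: distrib_left sum.distrib sum_distrib_right[symmetric])
qed

lemma sum_moment_fun_nonneg:
  "(\<Sum>x\<in>X. \<Sum>y\<in>X. moment_fun (gram U s x y) (gram U' s' x y)) \<ge> 0"
  using sum_gram_cosh_sqrt_nonneg[of U s U' s' X] sum_gram_cosh_sqrt_nonneg[of U' s' U s X]
  by (simp add: moment_fun_def sum.distrib)

lemma sum_exp_minus_le: "(\<Sum>n\<le>L. exp (- 2 * real n)) \<le> 2"
proof -
  have e: "exp (- 2 :: real) \<le> 1 / 2"
    using exp_ge_add_one_self[of "2::real"] by (simp add: exp_minus field_simps)
  have "(\<Sum>n\<le>L. exp (- 2 * real n)) = (\<Sum>n\<le>L. exp (- 2) ^ n)"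
    by (simp add: exp_of_nat_mult[symmetric] mult.commute)
  also have "\<dots> \<le> (\<Sum>n\<le>L. (1 / 2) ^ n)"
    using e by (intro sum_mono power_mono) auto
  also have "\<dots> = 2 - (1 / 2) ^ L"
    by (induction L) auto
  also have "\<dots> \<le> 2" by simp
  finally show ?thesis .
qed

text \<open>If all these level sets were too small, every row sum of \<open>moment_fun\<close> would
  be negative: by the case n = 0 almost all pairs of a row have an argument below -6 and contribute
  at most -1, and the large values are too rare to compensate. This contradicts
  \<open>sum_moment_fun_nonneg\<close>.\<close>

lemma correlation_lemma:
  fixes s :: "bool \<Rightarrow> 'a \<Rightarrow> 'u \<Rightarrow> real" and U :: "bool \<Rightarrow> 'u set"
  assumes X: "finite X" "X \<noteq> {}"
  defines "K \<equiv> \<lambda>i. gram (U i) (s i)"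
  shows "\<exists>x\<in>X. \<exists>i n. real (card {y\<in>X. (n > 0 \<longrightarrow> K i x y \<ge> real n ^ 2) \<and> (\<forall>j. K j x y \<ge> - 6)})
           \<ge> exp (- 4 * real n) / 1000 * real (card X)"
proof (rule ccontr)
  assume neg: "\<not> ?thesis"
  define c where "c = real (card X)"
  have c: "c > 0" using X by (simp add: c_def card_gt_0_iff)
  define good where "good = (\<lambda>x y. \<forall>j. K j x y \<ge> - 6)"
  define M where "M = (\<lambda>x y. max 0 (max (K True x y) (K False x y)))"
  have small: "real (card {y\<in>X. (n > 0 \<longrightarrow> K i x y \<ge> real n ^ 2) \<and> good x y})
      < exp (- 4 * real n) / 1000 * c" if "x \<in> X" for x i n
    using neg that unfolding good_def c_def by (auto simp: not_le)
  define L where "L = nat \<lfloor>Max ((\<lambda>(x, y). sqrt (M x y)) ` (X \<times> X))\<rfloor>"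
  have L: "nat \<lfloor>sqrt (M x y)\<rfloor> \<le> L" if "x \<in> X" "y \<in> X" for x y
    unfolding L_def using X that
    by (intro nat_mono floor_mono Max_ge) auto
  \<comment> \<open>The single term with n the integer part of sqrt (M x y) already dominates, since
    the root is at most n + 1.\<close>
  have exp_bound: "exp (2 * sqrt (M x y)) \<le>
      (\<Sum>n\<le>L. if real n ^ 2 \<le> M x y then exp (2 * real n + 2) else 0)"
    if "x \<in> X" "y \<in> X" for x y
  proof -
    define m where "m = nat \<lfloor>sqrt (M x y)\<rfloor>"
    have M0: "M x y \<ge> 0" by (simp add: M_def)
    have m: "real m \<le> sqrt (M x y)" "sqrt (M x y) \<le> real m + 1"
      using M0 by (auto simp: m_def)
    have "real m ^ 2 \<le> sqrt (M x y) ^ 2" using m by (intro power_mono) auto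
    then have m2: "real m ^ 2 \<le> M x y" using M0 by simp
    have "exp (2 * sqrt (M x y)) \<le> exp (2 * real m + 2)" using m by simp
    also have "\<dots> = (if real m ^ 2 \<le> M x y then exp (2 * real m + 2) else 0)" using m2 by simp
    also have "\<dots> \<le> (\<Sum>n\<le>L. if real n ^ 2 \<le> M x y then exp (2 * real n + 2) else 0)"
      using L[OF that] by (intro member_le_sum) (auto simp: m_def)
    finally show ?thesis .
  qed
  have mf: "moment_fun (K True x y) (K False x y) \<le>
       12 * (\<Sum>n\<le>L. if real n ^ 2 \<le> M x y \<and> good x y then exp (2 * real n + 2) else 0)
        + (if good x y then 1 else 0) - 1" if "x \<in> X" "y \<in> X" for x y
  proof (cases "good x y")
    case True
    have "moment_fun (K True x y) (K False x y) \<le> 12 * exp (2 * sqrt (M x y))"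
      by (rule moment_fun_le) (auto simp: M_def)
    then show ?thesis using exp_bound[OF that] True by simp
  next
    case False
    then have "K True x y < - 6 \<or> K False x y < - 6"
      unfolding good_def by (metis (full_types) not_le)
    then show ?thesis using moment_fun_neg False by simp
  qed
  \<comment> \<open>The weight exp (2 * n + 2) meets at most 2 * exp (- 4 * n) / 1000 * c elements,
    half of that bound for each colour; with exp 2 <= 10 this leaves exp (- 2 * n) * c / 50.\<close>
  have cnt: "(\<Sum>y\<in>X. if real n ^ 2 \<le> M x y \<and> good x y then exp (2 * real n + 2) else 0)
       \<le> exp (- 2 * real n) * (c / 50)" if "x \<in> X" for x n
  proof -
    let ?S = "\<lambda>i. {y\<in>X. (n > 0 \<longrightarrow> K i x y \<ge> real n ^ 2) \<and> good x y}"
    have "{y\<in>X. real n ^ 2 \<le> M x y \<and> good x y} \<subseteq> ?S True \<union> ?S False"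
      by (auto simp: M_def le_max_iff_disj)
    then have "card {y\<in>X. real n ^ 2 \<le> M x y \<and> good x y} \<le> card (?S True \<union> ?S False)"
      using X by (intro card_mono) auto
    also have "\<dots> \<le> card (?S True) + card (?S False)" by (rule card_Un_le)
    finally have "real (card {y\<in>X. real n ^ 2 \<le> M x y \<and> good x y})
        \<le> exp (- 4 * real n) / 500 * c"
      using small[OF that, of n True] small[OF that, of n False] by linarith
    then have "exp (2 * real n + 2) * real (card {y\<in>X. real n ^ 2 \<le> M x y \<and> good x y})
        \<le> exp (2 * real n + 2) * (exp (- 4 * real n) / 500 * c)"
      by (intro mult_left_mono) auto
    also have "\<dots> = exp 2 * (exp (- 2 * real n) * (c / 500))"
      by (simp add: mult_exp_exp algebra_simps)
    also have "\<dots> \<le> 10 * (exp (- 2 * real n) * (c / 500))"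
    proof (rule mult_right_mono)
      have "exp (2::real) = exp 1 ^ 2" by (simp add: exp_of_nat_mult[symmetric])
      also have "\<dots> \<le> 3 ^ 2" using exp_le by (intro power_mono) auto
      finally show "exp (2::real) \<le> 10" by simp
    qed (use c in auto)
    finally show ?thesis
      using X by (simp add: sum.inter_filter[symmetric] mult.commute)
  qed
  have good_cnt: "(\<Sum>y\<in>X. if good x y then 1 else 0) \<le> c / 1000" if "x \<in> X" for x
    using small[OF that, of 0] X by (simp add: sum.inter_filter[symmetric])
  have row: "(\<Sum>y\<in>X. moment_fun (K True x y) (K False x y)) < 0" if "x \<in> X" for x
  proof -
    have "(\<Sum>y\<in>X. moment_fun (K True x y) (K False x y))
        \<le> (\<Sum>y\<in>X. 12 * (\<Sum>n\<le>L. if real n ^ 2 \<le> M x y \<and> good x y then exp (2 * real n + 2) else 0)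
        + (if good x y then 1 else 0) - 1)"
      using mf that by (intro sum_mono) auto
    also have "\<dots> = 12 * (\<Sum>y\<in>X. \<Sum>n\<le>L. if real n ^ 2 \<le> M x y \<and> good x y then exp (2 * real n + 2) else 0)
        + (\<Sum>y\<in>X. if good x y then 1 else 0) - c"
      by (simp add: sum.distrib sum_subtractf sum_distrib_left[symmetric] c_def del: sum.delta sum.delta')
    \<comment> \<open>The levels form a geometric series with sum at most 2, so they contribute at
      most c / 25 before the factor 12.\<close>
    also have "\<dots> \<le> 12 * (c / 25) + c / 1000 - c"
    proof -
      have "(\<Sum>y\<in>X. \<Sum>n\<le>L. if real n ^ 2 \<le> M x y \<and> good x y then exp (2 * real n + 2) else 0)
          = (\<Sum>n\<le>L. \<Sum>y\<in>X. if real n ^ 2 \<le> M x y \<and> good x y then exp (2 * real n + 2) else 0)"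
        by (rule sum.swap)
      also have "\<dots> \<le> (\<Sum>n\<le>L. exp (- 2 * real n) * (c / 50))"
        by (intro sum_mono cnt that)
      also have "\<dots> = (\<Sum>n\<le>L. exp (- 2 * real n)) * (c / 50)"
        by (rule sum_distrib_right[symmetric])
      also have "\<dots> \<le> 2 * (c / 50)"
        using c by (intro mult_right_mono sum_exp_minus_le) auto
      finally show ?thesis using good_cnt[OF that] by simp
    qed
    also have "\<dots> < 0" using c by simp
    finally show ?thesis .
  qed
  have "(\<Sum>x\<in>X. \<Sum>y\<in>X. moment_fun (K True x y) (K False x y)) < (\<Sum>x\<in>X. 0)"
    using X row by (intro sum_strict_mono) auto
  then show False
    using sum_moment_fun_nonneg[of "U True" "s True" "U False" "s False" X] by (simp add: K_def)
qed

section \<open>Monochromatic books\<close>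

definition nbrs :: "'v set set \<Rightarrow> bool \<Rightarrow> 'v \<Rightarrow> 'v set" where
  "nbrs C i x = {y. y \<noteq> x \<and> ({x, y} \<in> C \<longleftrightarrow> i)}"

definition mono_clique :: "'v set set \<Rightarrow> bool \<Rightarrow> 'v set \<Rightarrow> bool" where
  "mono_clique C i K \<longleftrightarrow> (\<forall>x\<in>K. K - {x} \<subseteq> nbrs C i x)"

text \<open>A colouring of all pairs is encoded by the set \<open>C\<close> of pairs of colour
  \<open>True\<close>, its complement being colour \<open>False\<close>. If this holds for all
  \<open>C\<close>, the Ramsey number R(k True, k False) is at most the size of
  \<open>V\<close>.\<close>

definition has_mono :: "'v set set \<Rightarrow> 'v set \<Rightarrow> (bool \<Rightarrow> nat) \<Rightarrow> bool" where
  "has_mono C V k \<longleftrightarrow> (\<exists>i K. K \<subseteq> V \<and> finite K \<and> card K = k i \<and> mono_clique C i K)"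

lemma nbrs_sym: "y \<in> nbrs C i x \<longleftrightarrow> x \<in> nbrs C i y"
  by (auto simp: nbrs_def insert_commute)

lemma nbrs_irrefl [simp]: "x \<notin> nbrs C i x"
  by (simp add: nbrs_def)

lemma nbrs_Un: "nbrs C True x \<union> nbrs C False x = - {x}"
  by (auto simp: nbrs_def)

lemma mono_clique_Un:
  assumes "mono_clique C i S" "mono_clique C i K" "\<And>x. x \<in> S \<Longrightarrow> K \<subseteq> nbrs C i x"
  shows "mono_clique C i (S \<union> K)"
  unfolding mono_clique_def
proof
  fix x assume "x \<in> S \<union> K"
  then show "S \<union> K - {x} \<subseteq> nbrs C i x"
  proof
    assume "x \<in> S"
    then show ?thesis using assms(1,3) by (auto simp: mono_clique_def)
  next
    assume x: "x \<in> K"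
    then have "y \<in> nbrs C i x" if "y \<in> S" for y
      using assms(3)[OF that] nbrs_sym[of x C i y] by blast
    then show ?thesis using assms(2) x by (auto simp: mono_clique_def)
  qed
qed

lemma has_mono_zero: "k i = 0 \<Longrightarrow> has_mono C V k"
  unfolding has_mono_def mono_clique_def by (intro exI[of _ i] exI[of _ "{}"]) auto

text \<open>Every recursion below passes to a common neighbourhood through this: a clique found in
  colour \<open>i\<close> is completed by \<open>S\<close>, and the target of the other colour has
  not changed.\<close>

lemma has_mono_extend:
  assumes S: "finite S" "S \<subseteq> V" "mono_clique C i S" "card S \<le> k i"
    and W: "W \<subseteq> V" "\<And>x. x \<in> S \<Longrightarrow> W \<subseteq> nbrs C i x"
    and "has_mono C W (k(i := k i - card S))"
  shows "has_mono C V k"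
proof -
  obtain j K where K: "K \<subseteq> W" "finite K" "card K = (k(i := k i - card S)) j" "mono_clique C j K"
    using assms(7) unfolding has_mono_def by blast
  show ?thesis
  proof (cases "j = i")
    case True
    have "x \<notin> K" if "x \<in> S" for x
      using W(2)[OF that] K(1) nbrs_irrefl[of x C i] by blast
    then have "S \<inter> K = {}" by blast
    then have "card (S \<union> K) = k i"
      using K(2,3) S(1,4) True by (simp add: card_Un_disjoint)
    moreover have "mono_clique C i (S \<union> K)"
      using mono_clique_Un[OF S(3), of K] K(1,4) W(2) True by blast
    ultimately show ?thesis
      unfolding has_mono_def using K(1,2) S(1,2) W(1) by (intro exI[of _ i] exI[of _ "S \<union> K"]) auto
  next
    case False
    then show ?thesis
      unfolding has_mono_def using K W(1) by (intro exI[of _ j] exI[of _ K]) auto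
  qed
qed

text \<open>\<open>correlation_lemma\<close> is applied to centred indicator vectors of sets
  \<open>A x j\<close>, the neighbourhoods cut down to the common size \<open>m j\<close>. With the
  scaling by sqrt (\<alpha> j * m j), a kernel value r means that \<open>A x j\<close> and
  \<open>A y j\<close> share exactly (p j + r * \<alpha> j) * m j elements, which are neighbours of
  \<open>y\<close>.\<close>

lemma book_step:
  fixes Y :: "bool \<Rightarrow> 'v set" and m :: "bool \<Rightarrow> nat" and \<alpha> :: "bool \<Rightarrow> real"
  assumes X: "finite X" "X \<noteq> {}"
    and Y: "\<And>i. finite (Y i)" and m: "\<And>i. m i > 0"
    and deg: "\<And>i x. x \<in> X \<Longrightarrow> m i \<le> card (nbrs C i x \<inter> Y i)"
    and \<alpha>: "\<And>i. \<alpha> i > 0"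
  obtains x A i n X' where "x \<in> X" "\<And>j. A j \<subseteq> nbrs C j x \<inter> Y j" "\<And>j. card (A j) = m j"
    "X' \<subseteq> X" "real (card X') \<ge> exp (- 4 * real n) / 1000 * real (card X)"
    "\<And>y j. y \<in> X' \<Longrightarrow>
        real (card (nbrs C j y \<inter> A j)) \<ge> (real (m j) / real (card (Y j)) - 6 * \<alpha> j) * real (m j)"
    "\<And>y. n > 0 \<Longrightarrow> y \<in> X' \<Longrightarrow>
        real (card (nbrs C i y \<inter> A i)) \<ge> (real (m i) / real (card (Y i)) + real n ^ 2 * \<alpha> i) * real (m i)"
proof -
  have "\<forall>x\<in>X. \<forall>j. \<exists>B. B \<subseteq> nbrs C j x \<inter> Y j \<and> card B = m j"
    using deg obtain_subset_with_card_n by metis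
  then obtain A where A: "\<And>x j. x \<in> X \<Longrightarrow> A x j \<subseteq> nbrs C j x \<inter> Y j"
      "\<And>x j. x \<in> X \<Longrightarrow> card (A x j) = m j"
    by metis
  define p where "p = (\<lambda>j. real (m j) / real (card (Y j)))"
  define s where "s = (\<lambda>j x u. ((if u \<in> A x j then 1 else 0) - p j) / sqrt (\<alpha> j * real (m j)))"
  have cY: "card (Y j) > 0" for j
  proof -
    obtain x where "x \<in> X" using X by blast
    then have "0 < card (nbrs C j x \<inter> Y j)" using deg m by (metis less_le_trans)
    then show ?thesis using Y by (auto simp: card_gt_0_iff)
  qed
  have gram_eq: "gram (Y j) (s j) x y = (real (card (A x j \<inter> A y j)) - p j * real (m j)) / (\<alpha> j * real (m j))"
    if xy: "x \<in> X" "y \<in> X" for x y j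
  proof -
    have sub: "A x j \<subseteq> Y j" "A y j \<subseteq> Y j" using A xy by blast+
    have ind: "(\<Sum>u\<in>Y j. if u \<in> B then 1 else 0) = real (card B)" if "B \<subseteq> Y j" for B
      using that Y[of j] by (simp add: sum.inter_restrict[symmetric] Int_absorb1)
    have "gram (Y j) (s j) x y = (\<Sum>u\<in>Y j. ((if u \<in> A x j then 1 else 0) - p j)
          * ((if u \<in> A y j then 1 else 0) - p j)) / (\<alpha> j * real (m j))"
      unfolding gram_def s_def sum_divide_distrib using \<alpha>[of j] m[of j] by (intro sum.cong refl) simp
    also have "(\<Sum>u\<in>Y j. ((if u \<in> A x j then 1 else 0) - p j) * ((if u \<in> A y j then 1 else 0) - p j))
       = (\<Sum>u\<in>Y j. (if u \<in> A x j \<inter> A y j then 1 else 0) - p j * (if u \<in> A x j then 1 else 0)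
            - p j * (if u \<in> A y j then 1 else 0) + p j * p j)"
      by (intro sum.cong refl) (auto simp: algebra_simps)
    also have "\<dots> = real (card (A x j \<inter> A y j)) - p j * real (m j) - p j * real (m j) + p j * p j * real (card (Y j))"
      using sub ind[of "A x j"] ind[of "A y j"] ind[of "A x j \<inter> A y j"] A(2)[OF xy(1), of j] A(2)[OF xy(2), of j]
      by (simp only: sum.distrib sum_subtractf sum_distrib_left[symmetric] sum_constant) auto
    \<comment> \<open>As p j is the density of every \<open>A x j\<close> in \<open>Y j\<close>, the
      square term cancels one of the two cross terms.\<close>
    also have "p j * p j * real (card (Y j)) = p j * real (m j)"
      using cY[of j] by (simp add: p_def)
    finally show ?thesis by simp
  qed
  have gram_le: "real (card (nbrs C j y \<inter> A x j)) \<ge> (p j + r * \<alpha> j) * real (m j)"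
    if "x \<in> X" "y \<in> X" "gram (Y j) (s j) x y \<ge> r" for x y j r
  proof -
    have "r * (\<alpha> j * real (m j)) \<le> real (card (A x j \<inter> A y j)) - p j * real (m j)"
      using that(3) \<alpha>[of j] m[of j] unfolding gram_eq[OF that(1,2)] by (simp add: pos_le_divide_eq)
    moreover have "card (A x j \<inter> A y j) \<le> card (nbrs C j y \<inter> A x j)"
      using A(1)[OF that(1), of j] A(1)[OF that(2), of j] Y[of j]
      by (intro card_mono) (auto intro: finite_subset)
    ultimately show ?thesis by (simp add: algebra_simps)
  qed
  obtain x i n where x: "x \<in> X" and
    large: "real (card {y\<in>X. (n > 0 \<longrightarrow> gram (Y i) (s i) x y \<ge> real n ^ 2) \<and> (\<forall>j. gram (Y j) (s j) x y \<ge> - 6)})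
           \<ge> exp (- 4 * real n) / 1000 * real (card X)"
    using correlation_lemma[OF X, of Y s] by blast
  show ?thesis
  proof (rule that[OF x _ _ _ large, of "A x"])
    fix y j assume "y \<in> {y\<in>X. (n > 0 \<longrightarrow> gram (Y i) (s i) x y \<ge> real n ^ 2) \<and> (\<forall>j. gram (Y j) (s j) x y \<ge> - 6)}"
    then show "(real (m j) / real (card (Y j)) - 6 * \<alpha> j) * real (m j) \<le> real (card (nbrs C j y \<inter> A x j))"
      using gram_le[of x y "- 6" j] x by (auto simp: p_def)
  next
    fix y assume "n > 0"
      "y \<in> {y\<in>X. (n > 0 \<longrightarrow> gram (Y i) (s i) x y \<ge> real n ^ 2) \<and> (\<forall>j. gram (Y j) (s j) x y \<ge> - 6)}"
    then show "(real (m i) / real (card (Y i)) + real n ^ 2 * \<alpha> i) * real (m i) \<le> real (card (nbrs C i y \<inter> A x i))"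
      using gram_le[of x y "real n ^ 2" i] x by (auto simp: p_def)
  qed (use A x in auto)
qed

section \<open>The book algorithm\<close>

definition remaining :: "nat \<Rightarrow> (bool \<Rightarrow> nat) \<Rightarrow> nat" where
  "remaining T t = (T - t True) + (T - t False)"

lemma remaining_upd: "t j < T \<Longrightarrow> remaining T t = Suc (remaining T (t(j := Suc (t j))))"
  by (cases j) (auto simp: remaining_def)

text \<open>Every vertex of the reservoir starts with density at least \<open>p0\<close> in
  \<open>Y0\<close>, and densities stay above \<open>p0 - \<delta>\<close>. The condition on
  \<open>a\<close> says that \<open>T\<close> clique steps at most halve the excess over
  \<open>p0 - \<delta>\<close>; the condition on \<open>B\<close> says that \<open>B\<close> boosts
  would then raise it above 1. \<open>E1\<close> and \<open>E2\<close> are the factors by which one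
  clique step or one boost may shrink the reservoir.\<close>

context
  fixes p0 \<delta> a E1 E2 :: real and n0 T B :: nat and C :: "'v set set" and V Y0 :: "'v set"
  assumes Y0: "finite Y0" "Y0 \<noteq> {}"
    and \<delta>: "0 < \<delta>" "\<delta> < p0" "p0 \<le> 1"
    and a: "0 < a" "6 * a < 1" "(1 - 6 * a) ^ T \<ge> 1 / 2"
    and n0: "n0 \<ge> 1" and B: "\<delta> / 2 * (1 + real n0 ^ 2 * a) ^ B > 1"
    and E1: "E1 \<ge> 4000 * exp (4 * real n0)"
    and E2: "E2 \<ge> 1000 * exp (4 * sqrt (2 / (a * \<delta>)))"
begin

text \<open>The guaranteed excess of a density over \<open>p0 - \<delta>\<close> after
  \<open>t\<close> clique steps and \<open>b\<close> boosts in its colour.\<close>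

definition density_bound :: "nat \<Rightarrow> nat \<Rightarrow> real" where
  "density_bound t b = \<delta> * (1 - 6 * a) ^ t * (1 + real n0 ^ 2 * a) ^ b"

lemma density_bound_ge:
  assumes "t \<le> T"
  shows "density_bound t b \<ge> \<delta> / 2 * (1 + real n0 ^ 2 * a) ^ b"
proof -
  have "1 / 2 \<le> (1 - 6 * a) ^ t"
    using a assms by (intro order_trans[OF a(3)] power_decreasing) auto
  then have "\<delta> * (1 / 2) * (1 + real n0 ^ 2 * a) ^ b \<le> \<delta> * (1 - 6 * a) ^ t * (1 + real n0 ^ 2 * a) ^ b"
    using \<delta> a by (intro mult_right_mono mult_left_mono) auto
  then show ?thesis by (simp add: density_bound_def)
qed

text \<open>The state consists of a reservoir \<open>X\<close> and, for each colour \<open>i\<close>, a clique \<open>S i\<close> of size \<open>t i\<close> and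
  a set \<open>Y i\<close> after \<open>b i\<close> boosts. If \<open>book_step\<close> yields a level \<open>n < n0\<close>, its vertex joins a clique, at the
  price of a factor \<open>1 - 6 * a\<close> in the excess density of that colour; otherwise the excess density of one
  colour is multiplied by at least \<open>1 + n0\<^sup>2 * a\<close>, which happens fewer than \<open>B\<close> times since densities are
  at most 1. As densities are bounded, \<open>n\<close> is at most \<open>sqrt (2 / (a * \<delta>))\<close>, whence the cost \<open>E2\<close>.\<close>

lemma book_induct:
  fixes X :: "'v set" and S Y :: "bool \<Rightarrow> 'v set" and t b :: "bool \<Rightarrow> nat"
  assumes "finite X" "X \<subseteq> V"
    and "\<And>i. S i \<subseteq> V" "\<And>i. finite (S i)" "\<And>i. card (S i) = t i" "\<And>i. mono_clique C i (S i)"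
    and "\<And>i x. x \<in> S i \<Longrightarrow> Y i \<subseteq> nbrs C i x" "\<And>i x. x \<in> S i \<Longrightarrow> X \<subseteq> nbrs C i x"
    and "\<And>i. t i < T" "\<And>i. b i < B"
    and "real (card X) \<ge> E1 ^ remaining T t * E2 ^ remaining B b"
    and "\<And>i. Y i \<subseteq> Y0" "\<And>i. (p0 - \<delta>) ^ (t i + b i) * real (card Y0) \<le> real (card (Y i))"
    and "\<And>i x. x \<in> X \<Longrightarrow>
      (p0 - \<delta> + density_bound (t i) (b i)) * real (card (Y i)) \<le> real (card (nbrs C i x \<inter> Y i))"
  shows "\<exists>i S W. S \<subseteq> V \<and> finite S \<and> card S = T \<and> mono_clique C i S \<and> W \<subseteq> Y0
      \<and> (\<forall>x\<in>S. W \<subseteq> nbrs C i x) \<and> (p0 - \<delta>) ^ (T + B) * real (card Y0) \<le> real (card W)"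
  using assms
proof (induction "remaining T t + remaining B b" arbitrary: X S Y t b rule: less_induct)
  case less
  note IH = less.hyps and finX = less.prems(1) and XV = less.prems(2) and SV = less.prems(3)
    and finS = less.prems(4) and cardS = less.prems(5) and monoS = less.prems(6)
    and SY = less.prems(7) and SX = less.prems(8) and tT = less.prems(9) and bB = less.prems(10)
    and cardX = less.prems(11) and YY0 = less.prems(12) and cardY = less.prems(13)
    and dens = less.prems(14)
  have E1_1: "E1 \<ge> 4000" 
    using E1 exp_ge_add_one_self[of "4 * real n0"] by linarith
  have E2_1: "E2 \<ge> 1000"
  proof -
    have "sqrt (2 / (a * \<delta>)) \<ge> 0" using a \<delta> by simp
    then show ?thesis
      using E2 exp_ge_add_one_self[of "4 * sqrt (2 / (a * \<delta>))"] by linarith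
  qed
  have finY: "finite (Y i)" for i using YY0 Y0 finite_subset by blast
  have cY0: "real (card Y0) > 0" using Y0 by (simp add: card_gt_0_iff)
  have cY: "real (card (Y i)) > 0" for i
    using cardY[of i] cY0 \<delta> by (smt (verit) mult_pos_pos zero_less_power)
  have cX: "real (card X) > 0"
    using cardX E1_1 E2_1 by (smt (verit) mult_pos_pos zero_less_power)
  have X0: "X \<noteq> {}" using cX by auto
  define L where "L = (\<lambda>i. p0 - \<delta> + density_bound (t i) (b i))"
  \<comment> \<open>Rounding up the guaranteed number of neighbours gives an attainable common size
    whose density \<open>p i\<close> is still at least \<open>L i\<close>.\<close>
  define m where "m = (\<lambda>i. nat \<lceil>L i * real (card (Y i))\<rceil>)"
  define p where "p = (\<lambda>i. real (m i) / real (card (Y i)))"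
  \<comment> \<open>The excess of the current density over \<open>p0 - \<delta>\<close>.
    Correlations are measured in units of \<open>a * q i\<close>, which makes losses and gains
    multiplicative in the excess.\<close>
  define q where "q = (\<lambda>i. p i - p0 + \<delta>)"
  have db: "density_bound (t i) (b i) \<ge> \<delta> / 2" for i
  proof -
    have "\<delta> / 2 * 1 \<le> \<delta> / 2 * (1 + real n0 ^ 2 * a) ^ b i"
      using \<delta> a by (intro mult_left_mono one_le_power) auto
    then show ?thesis using density_bound_ge[of "t i" "b i"] tT[of i] by linarith
  qed
  have Lpos: "L i > p0 - \<delta>" "L i > 0" for i using db[of i] \<delta> by (auto simp: L_def)
  have mL: "L i * real (card (Y i)) \<le> real (m i)" for i
    unfolding m_def by linarith
  have m0: "m i > 0" for i
    using mL[of i] Lpos[of i] cY[of i] by (smt (verit) mult_pos_pos of_nat_0_less_iff)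
  have mdeg: "m i \<le> card (nbrs C i x \<inter> Y i)" if "x \<in> X" for i x
    using dens[OF that, of i] unfolding m_def L_def by (simp add: ceiling_le_iff nat_le_iff)
  have pL: "p i \<ge> L i" for i using mL[of i] cY[of i] by (simp add: p_def pos_le_divide_eq)
  have q: "q i \<ge> density_bound (t i) (b i)" for i using pL[of i] by (simp add: q_def L_def)
  have q0: "q i > 0" for i using q[of i] db[of i] \<delta> by linarith
  \<comment> \<open>Each step, clique step or boost, costs \<open>Y i\<close> at most one factor
    \<open>p0 - \<delta>\<close>.\<close>
  have mY: "(p0 - \<delta>) ^ (Suc (t i + b i)) * real (card Y0) \<le> real (m i)" for i
  proof -
    have "(p0 - \<delta>) ^ (Suc (t i + b i)) * real (card Y0) = (p0 - \<delta>) * ((p0 - \<delta>) ^ (t i + b i) * real (card Y0))"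
      by simp
    also have "\<dots> \<le> (p0 - \<delta>) * real (card (Y i))" using cardY[of i] \<delta> by (intro mult_left_mono) auto
    also have "\<dots> \<le> L i * real (card (Y i))" using Lpos[of i] by (intro mult_right_mono) auto
    also have "\<dots> \<le> real (m i)" by (rule mL)
    finally show ?thesis .
  qed
  obtain x A i n X' where x: "x \<in> X" and A: "\<And>j. A j \<subseteq> nbrs C j x \<inter> Y j" "\<And>j. card (A j) = m j"
    and X': "X' \<subseteq> X" "real (card X') \<ge> exp (- 4 * real n) / 1000 * real (card X)"
    and lo: "\<And>y j. y \<in> X' \<Longrightarrow> real (card (nbrs C j y \<inter> A j)) \<ge> (p j - 6 * (a * q j)) * real (m j)"
    and hi: "\<And>y. n > 0 \<Longrightarrow> y \<in> X' \<Longrightarrow>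
        real (card (nbrs C i y \<inter> A i)) \<ge> (p i + real n ^ 2 * (a * q i)) * real (m i)"
    using book_step[OF finX X0 finY m0 mdeg, of "\<lambda>i. a * q i"] a q0 unfolding p_def by (metis mult_pos_pos)
  have finX': "finite X'" using X' finX finite_subset by blast
  have AY: "A j \<subseteq> Y j" "A j \<subseteq> nbrs C j x" for j using A by blast+
  have finA: "finite (A j)" for j using AY finY finite_subset by blast
  have cX': "real (card X') > 0"
    using X'(2) cX by (smt (verit) exp_gt_zero divide_pos_pos mult_pos_pos)
  show ?case
  proof (cases "n \<ge> n0")
    case True
    then have n: "n > 0" using n0 by simp
    \<comment> \<open>One vertex of \<open>X'\<close> is enough to bound the boosted density by 1,
      as its neighbours are counted inside a set of size \<open>m i\<close>.\<close>
    obtain y where y: "y \<in> X'" using cX' by (auto simp: card_gt_0_iff)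
    have "card (nbrs C i y \<inter> A i) \<le> m i"
      using A(2)[of i] finA[of i] by (metis card_mono inf_le2)
    then have "(p i + real n ^ 2 * (a * q i)) * real (m i) \<le> 1 * real (m i)"
      using hi[OF n y] by linarith
    then have le1: "p i + real n ^ 2 * (a * q i) \<le> 1"
      using m0[of i] by (simp only: mult_le_cancel_right_pos of_nat_0_less_iff)
    have boost: "(1 + real n0 ^ 2 * a) * density_bound (t i) (b i) \<le> q i + real n ^ 2 * (a * q i)"
    proof -
      have "(1 + real n0 ^ 2 * a) * density_bound (t i) (b i) \<le> (1 + real n ^ 2 * a) * q i"
        using q[of i] a True db[of i] \<delta> by (intro mult_mono add_left_mono mult_right_mono power_mono) auto
      then show ?thesis by (simp add: algebra_simps)
    qed
    have db': "density_bound (t i) (Suc (b i)) = (1 + real n0 ^ 2 * a) * density_bound (t i) (b i)"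
      by (simp add: density_bound_def)
    \<comment> \<open>A boost number \<open>B\<close> would raise the guaranteed excess above 1,
      against the bound just found.\<close>
    have bi: "Suc (b i) < B"
    proof (rule ccontr)
      assume "\<not> Suc (b i) < B"
      then have eq: "Suc (b i) = B" using bB[of i] by simp
      have "density_bound (t i) B > 1"
        using density_bound_ge[of "t i" B] B tT[of i] by simp
      moreover have "density_bound (t i) B \<le> 1"
        using boost db' le1 \<delta> unfolding eq q_def by linarith
      ultimately show False by simp
    qed
    have nmax: "real n \<le> sqrt (2 / (a * \<delta>))"
    proof (rule real_le_rsqrt)
      have "real n ^ 2 * (a * (\<delta> / 2)) \<le> real n ^ 2 * (a * q i)"
        using q[of i] db[of i] a by (intro mult_left_mono) auto
      also have "\<dots> \<le> 1" using le1 pL[of i] Lpos[of i] by linarith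
      finally show "real n ^ 2 \<le> 2 / (a * \<delta>)" using a \<delta> by (simp add: field_simps)
    qed
    let ?b = "b(i := Suc (b i))" and ?Y = "Y(i := A i)"
    have rem: "remaining B b = Suc (remaining B ?b)" by (rule remaining_upd[OF bB])
    show ?thesis
    proof (rule IH[of t ?b X' S ?Y])
      have "E2 \<ge> 1000 * exp (4 * real n)"
        using E2 nmax by (smt (verit) exp_le_cancel_iff)
      then have "1 \<le> exp (- 4 * real n) / 1000 * E2"
        by (simp add: exp_minus field_simps)
      then have "E1 ^ remaining T t * E2 ^ remaining B ?b * 1
          \<le> E1 ^ remaining T t * E2 ^ remaining B ?b * (exp (- 4 * real n) / 1000 * E2)"
        using E1_1 E2_1 by (intro mult_left_mono) auto
      also have "\<dots> = exp (- 4 * real n) / 1000 * (E1 ^ remaining T t * E2 ^ remaining B b)"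
        unfolding rem by simp
      also have "\<dots> \<le> exp (- 4 * real n) / 1000 * real (card X)"
        using cardX by (intro mult_left_mono) auto
      also have "\<dots> \<le> real (card X')" by (rule X'(2))
      finally show "E1 ^ remaining T t * E2 ^ remaining B ?b \<le> real (card X')" by simp
    next
      fix j y assume y: "y \<in> X'"
      show "(p0 - \<delta> + density_bound (t j) (?b j)) * real (card (?Y j)) \<le> real (card (nbrs C j y \<inter> ?Y j))"
      proof (cases "j = i")
        case True
        have "(p0 - \<delta> + density_bound (t i) (Suc (b i))) * real (m i)
            \<le> (p i + real n ^ 2 * (a * q i)) * real (m i)"
          using boost unfolding db' by (intro mult_right_mono) (auto simp: q_def)
        then show ?thesis using hi[OF n y] True A(2)[of i] by simp
      next
        case False
        then show ?thesis using dens[of y j] X'(1) y by auto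
      qed
    next
      fix j show "(p0 - \<delta>) ^ (t j + ?b j) * real (card Y0) \<le> real (card (?Y j))"
        using cardY[of j] mY[of j] A(2)[of j] by auto
    next
      fix j y assume "y \<in> S j" then show "?Y j \<subseteq> nbrs C j y" using SY[of y j] AY(1)[of j] by auto
    next
      fix j y assume "y \<in> S j" then show "X' \<subseteq> nbrs C j y" using SX[of y j] X'(1) by auto
    next
      fix j show "?b j < B" using bi bB by auto
    next
      fix j show "?Y j \<subseteq> Y0" using YY0[of j] AY(1)[of j] by auto
    next
      show "remaining T t + remaining B ?b < remaining T t + remaining B b" using rem by simp
    qed (use finX' X' XV SV finS cardS monoS tT in auto)
  next
    case False
    \<comment> \<open>Of the constant 4000 in \<open>E1\<close>, the factor 1000 pays for the
      correlation step and the factor 4 for restricting \<open>X'\<close> to one colour at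
      \<open>x\<close>.\<close>
    have E1': "4 \<le> exp (- 4 * real n) / 1000 * E1"
    proof -
      have "exp (4 * real n) \<le> exp (4 * real n0)" using False by simp
      then have "E1 \<ge> 4000 * exp (4 * real n)" using E1 by linarith
      then show ?thesis by (simp add: exp_minus field_simps)
    qed
    have cardX': "4 * real (card X) \<le> E1 * real (card X')"
    proof -
      have "4 * real (card X) \<le> exp (- 4 * real n) / 1000 * E1 * real (card X)"
        using E1' by (intro mult_right_mono) auto
      also have "\<dots> = E1 * (exp (- 4 * real n) / 1000 * real (card X))" by simp
      also have "\<dots> \<le> E1 * real (card X')" using X'(2) E1_1 by (intro mult_left_mono) auto
      finally show ?thesis .
    qed
    have "E1 \<le> real (card X)"
    proof -
      have "remaining T t = Suc (remaining T (t(True := Suc (t True))))" by (rule remaining_upd[OF tT])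
      then have "E1 * 1 * 1 \<le> E1 ^ remaining T t * E2 ^ remaining B b"
        using E1_1 E2_1 by (simp only: power_Suc) (intro mult_mono mult_left_mono one_le_power; simp)
      then show ?thesis using cardX by simp
    qed
    then have "E1 * 4 \<le> E1 * real (card X')" using cardX' by linarith
    then have X'4: "real (card X') \<ge> 4" using E1_1 by simp
    have "X' \<subseteq> insert x ((X' \<inter> nbrs C True x) \<union> (X' \<inter> nbrs C False x))"
      using nbrs_Un[of C x] by blast
    then have "card X' \<le> card (insert x ((X' \<inter> nbrs C True x) \<union> (X' \<inter> nbrs C False x)))"
      using finX' by (intro card_mono) auto
    also have "\<dots> \<le> Suc (card ((X' \<inter> nbrs C True x) \<union> (X' \<inter> nbrs C False x)))"
      by (rule card_insert_le_m1) auto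
    also have "\<dots> \<le> Suc (card (X' \<inter> nbrs C True x) + card (X' \<inter> nbrs C False x))"
      by (simp add: card_Un_le)
    finally have split: "card X' \<le> Suc (card (X' \<inter> nbrs C True x) + card (X' \<inter> nbrs C False x))" .
    \<comment> \<open>A quarter rather than a half leaves room for \<open>x\<close> itself, which
      may lie in \<open>X'\<close>; this is harmless because \<open>X'\<close> has at least 4
      elements.\<close>
    have "\<exists>j. real (card (X' \<inter> nbrs C j x)) \<ge> real (card X') / 4"
    proof (rule ccontr)
      assume "\<not> ?thesis"
      then have "real (card (X' \<inter> nbrs C True x)) < real (card X') / 4"
        "real (card (X' \<inter> nbrs C False x)) < real (card X') / 4"
        by (auto simp: not_le)
      then show False using split X'4 by linarith
    qed
    then obtain j where j: "real (card (X' \<inter> nbrs C j x)) \<ge> real (card X') / 4" by blast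
    let ?X = "X' \<inter> nbrs C j x" and ?t = "t(j := Suc (t j))" and ?S = "S(j := insert x (S j))"
      and ?Y = "Y(j := A j)"
    have xS: "x \<notin> S j" using SX[of x j] x nbrs_irrefl[of x C j] by blast
    have cardS': "card (insert x (S j)) = Suc (t j)" using xS finS[of j] cardS[of j] by simp
    have mono': "mono_clique C j (insert x (S j))"
      using mono_clique_Un[OF monoS[of j], of "{x}"] SX[of _ j] x by (auto simp: mono_clique_def)
    have Sx: "A j \<subseteq> nbrs C j y" if "y \<in> insert x (S j)" for y
      using that AY[of j] SY[of y j] by auto
    show ?thesis
    proof (cases "Suc (t j) = T")
      \<comment> \<open>The clique of colour \<open>j\<close> is complete and \<open>A j\<close> is
        its common neighbourhood, reached after \<open>T\<close> clique steps and fewer than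
        \<open>B\<close> boosts in this colour.\<close>
      case True
      have "(p0 - \<delta>) ^ (T + B) * real (card Y0) \<le> (p0 - \<delta>) ^ (Suc (t j + b j)) * real (card Y0)"
        using \<delta> True bB[of j] by (intro mult_right_mono power_decreasing) auto
      also have "\<dots> \<le> real (card (A j))" using mY[of j] A(2) by simp
      finally show ?thesis
        using cardS' True mono' Sx AY[of j] YY0[of j] x XV SV[of j] finS[of j]
        by (intro exI[of _ j] exI[of _ "insert x (S j)"] exI[of _ "A j"]) auto
    next
      case False
      have rem: "remaining T t = Suc (remaining T ?t)" by (rule remaining_upd[OF tT])
      show ?thesis
      proof (rule IH[of ?t b ?X ?S ?Y])
        have "E1 * (E1 ^ remaining T ?t * E2 ^ remaining B b) \<le> real (card X)"
          using cardX unfolding rem by simp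
        also have "\<dots> \<le> E1 * (real (card X') / 4)" using cardX' by simp
        also have "\<dots> \<le> E1 * real (card ?X)" using j E1_1 by (intro mult_left_mono) auto
        finally show "E1 ^ remaining T ?t * E2 ^ remaining B b \<le> real (card ?X)" using E1_1 by simp
      next
        fix l y assume y: "y \<in> ?X"
        show "(p0 - \<delta> + density_bound (?t l) (b l)) * real (card (?Y l)) \<le> real (card (nbrs C l y \<inter> ?Y l))"
        proof (cases "l = j")
          case True
          have "density_bound (Suc (t j)) (b j) = (1 - 6 * a) * density_bound (t j) (b j)"
            by (simp add: density_bound_def)
          also have "\<dots> \<le> (1 - 6 * a) * q j" using q[of j] a by (intro mult_left_mono) auto
          finally have "(p0 - \<delta> + density_bound (Suc (t j)) (b j)) * real (m j) \<le> (p j - 6 * (a * q j)) * real (m j)"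
            by (intro mult_right_mono) (auto simp: q_def algebra_simps)
          then show ?thesis using lo[of y j] y True A(2)[of j] by auto
        next
          case False
          then show ?thesis using dens[of y l] X'(1) y by auto
        qed
      next
        fix l show "(p0 - \<delta>) ^ (?t l + b l) * real (card Y0) \<le> real (card (?Y l))"
          using cardY[of l] mY[of l] A(2)[of l] by auto
      next
        fix l show "?t l < T" using tT[of l] tT[of j] False by auto
      next
        fix l y assume "y \<in> ?S l" then show "?Y l \<subseteq> nbrs C l y" using Sx SY[of y l] by (auto split: if_splits)
      next
        fix l y assume "y \<in> ?S l" then show "?X \<subseteq> nbrs C l y" using SX[of y l] X'(1) by (auto split: if_splits)
      next
        fix l show "?S l \<subseteq> V" using SV[of l] x XV by auto
      next
        fix l show "?Y l \<subseteq> Y0" using YY0[of l] AY[of l] by auto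
      next
        show "remaining T ?t + remaining B b < remaining T t + remaining B b" using rem by simp
      next
        fix l show "finite (?S l)" using finS by simp
      next
        fix l show "card (?S l) = ?t l" using cardS cardS' by simp
      next
        fix l show "mono_clique C l (?S l)" using monoS mono' by simp
      qed (use finX' X' XV bB in auto)
    qed
  qed
qed

lemma book_theorem:
  assumes "finite X" "X \<subseteq> V" "T > 0" "B > 0"
    and "real (card X) \<ge> E1 ^ (2 * T) * E2 ^ (2 * B)"
    and dens: "\<And>i x. x \<in> X \<Longrightarrow> p0 * real (card Y0) \<le> real (card (nbrs C i x \<inter> Y0))"
  shows "\<exists>i S W. S \<subseteq> V \<and> finite S \<and> card S = T \<and> mono_clique C i S \<and> W \<subseteq> Y0
      \<and> (\<forall>x\<in>S. W \<subseteq> nbrs C i x) \<and> (p0 - \<delta>) ^ (T + B) * real (card Y0) \<le> real (card W)"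
  \<comment> \<open>With empty cliques and no boosts the required density is
    \<open>p0 - \<delta> + \<delta>\<close>, that is \<open>p0\<close>.\<close>
  by (rule book_induct[of X "\<lambda>_. {}" "\<lambda>_. 0" "\<lambda>_. Y0" "\<lambda>_. 0"])
    (use assms in \<open>auto simp: mono_clique_def remaining_def density_bound_def mult_2\<close>)

end

section \<open>Ramsey bounds\<close>

text \<open>The summand 1 makes the pigeonhole step lossless: the neighbourhoods of a vertex in
  \<open>V\<close> have \<open>card V - 1\<close> elements altogether.\<close>

lemma erdos_szekeres_weighted:
  fixes w :: "bool \<Rightarrow> real"
  assumes w: "\<And>i. w i > 0" "w True + w False = 1"
    and "finite V" "\<not> has_mono C V k"
  shows "(real (card V) + 1) * (w True ^ k True * w False ^ k False) < 1"
  using assms(3,4)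
proof (induction "k True + k False" arbitrary: V k rule: less_induct)
  case less
  define W where "W = (\<lambda>k. w True ^ k True * w False ^ k False)"
  have k0: "k i > 0" for i using has_mono_zero[of k i] less.prems(2) by auto
  have wlt: "w i < 1" for i using w(1)[of "\<not> i"] w(2) by (cases i) auto
  have W_upd: "W k = w j * W (k(j := k j - 1))" for j
    using k0[of j] by (cases j) (auto simp: W_def power_eq_if)
  show ?case
  proof (cases "V = {}")
    case True
    have "w True ^ k True < 1" using wlt[of True] w(1)[of True] k0[of True] by (simp add: power_less_one_iff)
    moreover have "w False ^ k False \<le> 1" using wlt[of False] w(1)[of False] by (simp add: power_le_one)
    ultimately have "w True ^ k True * w False ^ k False < 1 * 1"
      using w(1) by (intro mult_less_le_imp_less) (auto simp: less_imp_le)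
    then show ?thesis using True by simp
  next
    case False
    then obtain x where x: "x \<in> V" by blast
    let ?N = "\<lambda>j. V \<inter> nbrs C j x"
    have IH: "(real (card (?N j)) + 1) * W k < w j" for j
    proof -
      let ?k = "k(j := k j - 1)"
      have "\<not> has_mono C (?N j) ?k"
        using has_mono_extend[of "{x}" V C j k "?N j"] x k0[of j] less.prems(2)
        by (auto simp: mono_clique_def)
      moreover have "?k True + ?k False < k True + k False" using k0[of j] by (cases j) auto
      ultimately have "(real (card (?N j)) + 1) * W ?k < 1"
        unfolding W_def using less.hyps[of ?k "?N j"] less.prems(1) by blast
      then have "w j * ((real (card (?N j)) + 1) * W ?k) < w j * 1"
        using w(1)[of j] by (intro mult_strict_left_mono) auto
      then show ?thesis unfolding W_upd[of j] by (simp add: mult_ac)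
    qed
    have "V = insert x (?N True \<union> ?N False)" using x nbrs_Un[of C x] by blast
    moreover have "?N True \<inter> ?N False = {}" by (auto simp: nbrs_def)
    ultimately have "card V = Suc (card (?N True) + card (?N False))"
      using less.prems(1) by (metis (no_types, lifting) Int_iff Un_iff card_Un_disjoint card_insert_disjoint
          finite_Int finite_UnI nbrs_irrefl)
    then have "(real (card V) + 1) * W k = (real (card (?N True)) + 1) * W k + (real (card (?N False)) + 1) * W k"
      by (simp add: algebra_simps)
    also have "\<dots> < 1" using IH[of True] IH[of False] w(2) by linarith
    finally show ?thesis by (simp add: W_def)
  qed
qed

text \<open>The weighted bound with weights (1 + \<theta>) / 2 for the larger target and (1 -
  \<theta>) / 2 for the smaller one gains a factor exp (d' * \<theta> - 2 * M * \<theta> ^ 2) over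
  equal weights.\<close>

lemma ramsey_off_diagonal:
  assumes "finite V" "\<not> has_mono C V k" "0 \<le> d" "d \<le> \<bar>real (k True) - real (k False)\<bar>"
  shows "real (card V) < 2 ^ (k True + k False) * exp (- (d\<^sup>2 / (8 * real (k True + k False))))"
proof -
  obtain i where i: "\<bar>real (k True) - real (k False)\<bar> = real (k i) - real (k (\<not> i))"
    by (cases "k True \<ge> k False") (auto intro: that[of True] that[of False])
  define d' where "d' = real (k i) - real (k (\<not> i))"
  define M where "M = real (k i + k (\<not> i))"
  have M_eq: "k True + k False = k i + k (\<not> i)" by (cases i) auto
  have d': "d \<le> d'" "0 \<le> d'" "d' \<le> M" using assms i by (auto simp: d'_def M_def)
  have M: "M > 0" using has_mono_zero[of k i C V] assms(2) by (cases "k i = 0") (auto simp: M_def)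
  \<comment> \<open>This choice maximises d' * \<theta> - 2 * M * \<theta> ^ 2, the maximum being d'
    ^ 2 / (8 * M).\<close>
  define \<theta> where "\<theta> = d' / (4 * M)"
  have \<theta>: "0 \<le> \<theta>" "\<theta> \<le> 1 / 4" using d' M by (auto simp: \<theta>_def divide_simps)
  define w where "w = (\<lambda>j. if j = i then (1 + \<theta>) / 2 else (1 - \<theta>) / 2)"
  have "(real (card V) + 1) * (w True ^ k True * w False ^ k False) < 1"
    by (rule erdos_szekeres_weighted[OF _ _ assms(1,2)]) (use \<theta> in \<open>auto simp: w_def field_simps\<close>)
  also have "w True ^ k True * w False ^ k False = w i ^ k i * w (\<not> i) ^ k (\<not> i)" by (cases i) auto
  also have "\<dots> = (1 + \<theta>) ^ k i * (1 - \<theta>) ^ k (\<not> i) / 2 ^ (k i + k (\<not> i))"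
    by (simp add: w_def power_divide power_add)
  finally have upper: "(real (card V) + 1) * ((1 + \<theta>) ^ k i * (1 - \<theta>) ^ k (\<not> i)) < 2 ^ (k i + k (\<not> i))"
    by (simp add: field_simps)
  have "exp (d'\<^sup>2 / (8 * M)) \<le> (1 + \<theta>) ^ k i * (1 - \<theta>) ^ k (\<not> i)"
  proof -
    have e1: "exp (\<theta> - \<theta>\<^sup>2) \<le> 1 + \<theta>"
      using ln_one_plus_pos_lower_bound[of \<theta>] \<theta> by (subst ln_ge_iff[symmetric]) auto
    have e2: "exp (- \<theta> - 2 * \<theta>\<^sup>2) \<le> 1 - \<theta>"
      using ln_one_minus_pos_lower_bound[of \<theta>] \<theta> by (subst ln_ge_iff[symmetric]) auto
    have "d'\<^sup>2 / (8 * M) = d' * \<theta> - 2 * M * \<theta>\<^sup>2"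
      using M by (simp add: \<theta>_def field_simps power2_eq_square)
    also have "\<dots> \<le> real (k i) * (\<theta> - \<theta>\<^sup>2) + real (k (\<not> i)) * (- \<theta> - 2 * \<theta>\<^sup>2)"
      by (simp add: d'_def M_def algebra_simps)
    finally have "exp (d'\<^sup>2 / (8 * M)) \<le> exp (\<theta> - \<theta>\<^sup>2) ^ k i * exp (- \<theta> - 2 * \<theta>\<^sup>2) ^ k (\<not> i)"
      by (simp add: exp_of_nat_mult[symmetric] mult_exp_exp)
    also have "\<dots> \<le> (1 + \<theta>) ^ k i * (1 - \<theta>) ^ k (\<not> i)"
      using e1 e2 \<theta> by (intro mult_mono power_mono) auto
    finally show ?thesis .
  qed
  then have "(real (card V) + 1) * exp (d'\<^sup>2 / (8 * M)) < 2 ^ (k i + k (\<not> i))"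
    using upper by (smt (verit) mult_left_mono of_nat_0_le_iff)
  moreover have "exp (d\<^sup>2 / (8 * M)) \<le> exp (d'\<^sup>2 / (8 * M))"
    using d' assms(3) M by (auto intro!: divide_right_mono power_mono)
  ultimately have "(real (card V) + 1) * exp (d\<^sup>2 / (8 * M)) < 2 ^ (k i + k (\<not> i))"
    by (smt (verit) mult_left_mono of_nat_0_le_iff)
  then have "real (card V) * exp (d\<^sup>2 / (8 * M)) < 2 ^ (k i + k (\<not> i))"
    by (smt (verit) exp_gt_zero mult_right_mono)
  then show ?thesis
    unfolding M_eq M_def[symmetric] by (simp add: exp_minus field_simps)
qed

text \<open>As long as some vertex has a colour degree of at least 1/2 + \<epsilon>, pass to that
  neighbourhood. Each move lowers one target by 1 and keeps more than the usual half of the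
  vertices; after \<open>J\<close> moves this surplus is large, and an earlier stop leaves nearly
  regular degrees.\<close>

lemma degree_regularisation:
  assumes "0 \<le> \<epsilon>" "finite V" "\<not> has_mono C V k"
  shows "\<exists>j V' k'. j \<le> J \<and> V' \<subseteq> V \<and> \<not> has_mono C V' k' \<and> k' True + k' False + j = k True + k False
     \<and> (\<forall>i. k' i \<le> k i) \<and> (1 / 2 + \<epsilon>) ^ j * real (card V) \<le> real (card V')
     \<and> (j = J \<or> (\<forall>x\<in>V'. \<forall>i. real (card (V' \<inter> nbrs C i x)) < (1 / 2 + \<epsilon>) * real (card V')))"
  using assms(2,3)
proof (induction J arbitrary: V k)
  case 0
  then show ?case by (intro exI[of _ 0] exI[of _ V] exI[of _ k]) auto
next
  case (Suc J)
  show ?case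
  proof (cases "\<forall>x\<in>V. \<forall>i. real (card (V \<inter> nbrs C i x)) < (1 / 2 + \<epsilon>) * real (card V)")
    case True
    then show ?thesis using Suc.prems by (intro exI[of _ 0] exI[of _ V] exI[of _ k]) auto
  next
    case False
    then obtain x i where x: "x \<in> V" and large: "(1 / 2 + \<epsilon>) * real (card V) \<le> real (card (V \<inter> nbrs C i x))"
      by (auto simp: not_less)
    let ?k = "k(i := k i - 1)"
    have k0: "k i > 0" using has_mono_zero[of k i] Suc.prems(2) by auto
    then have "\<not> has_mono C (V \<inter> nbrs C i x) ?k"
      using has_mono_extend[of "{x}" V C i k "V \<inter> nbrs C i x"] x Suc.prems(2)
      by (auto simp: mono_clique_def)
    then obtain j V' k' where IH: "j \<le> J" "V' \<subseteq> V \<inter> nbrs C i x" "\<not> has_mono C V' k'"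
      "k' True + k' False + j = ?k True + ?k False" "\<forall>i. k' i \<le> ?k i"
      "(1 / 2 + \<epsilon>) ^ j * real (card (V \<inter> nbrs C i x)) \<le> real (card V')"
      "j = J \<or> (\<forall>x\<in>V'. \<forall>i. real (card (V' \<inter> nbrs C i x)) < (1 / 2 + \<epsilon>) * real (card V'))"
      using Suc.IH[of "V \<inter> nbrs C i x" ?k] Suc.prems(1) by blast
    have "(1 / 2 + \<epsilon>) ^ Suc j * real (card V) = (1 / 2 + \<epsilon>) ^ j * ((1 / 2 + \<epsilon>) * real (card V))"
      by simp
    also have "\<dots> \<le> (1 / 2 + \<epsilon>) ^ j * real (card (V \<inter> nbrs C i x))"
      using large assms(1) by (intro mult_left_mono) auto
    finally have "(1 / 2 + \<epsilon>) ^ Suc j * real (card V) \<le> real (card V')" using IH(6) by linarith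
    moreover have "k' True + k' False + Suc j = k True + k False"
      using IH(4) k0 by (cases i) auto
    moreover have "k' l \<le> k l" for l
      using IH(5)[rule_format, of l] by (auto split: if_splits)
    ultimately show ?thesis
      using IH(1,2,3,7) by (intro exI[of _ "Suc j"] exI[of _ V'] exI[of _ k']) auto
  qed
qed

text \<open>Each named hypothesis serves one stage of a proof by contradiction:
  \<open>off_diag\<close> makes the targets nearly equal, \<open>regular\<close> rules out
  \<open>J\<close> moves of the regularisation, \<open>boosts\<close>, \<open>reservoir\<close> and
  \<open>large\<close> allow the book theorem to run, and \<open>book\<close> turns its book into an
  off-diagonal contradiction.\<close>

lemma ramsey_improved_conditional:
  fixes k :: "bool \<Rightarrow> nat" and \<epsilon> S :: real and T B J n0 M :: nat
  assumes V: "finite V" and M: "M = k True + k False" and pos: "T > 0" "B > 0" "n0 \<ge> 1" "S \<ge> 0"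
    and \<epsilon>: "0 < \<epsilon>" "\<epsilon> \<le> 1 / 12"
    and card_V: "2 ^ M * exp (- S) \<le> real (card V)"
    and JT: "4 * J \<le> T" and TM: "4 * T \<le> M"
    and off_diag: "S \<le> real T ^ 2 / (128 * real M)"
    and regular: "exp S \<le> (1 + 2 * \<epsilon>) ^ J"
    and book: "S + 12 * \<epsilon> * real (T + B) + real B \<le> real T ^ 2 / (32 * real M)"
    and boosts: "\<epsilon> / 2 * (1 + real n0 ^ 2 * (1 / (12 * real T))) ^ B > 1"
    and reservoir: "(4000 * exp (4 * real n0)) ^ (2 * T) * (1000 * exp (4 * sqrt (24 * real T / \<epsilon>))) ^ (2 * B)
        \<le> 2 ^ M * exp (- S) / 2 ^ J"
    and large: "1 \<le> \<epsilon> * (2 ^ M * exp (- S) / 2 ^ J)"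
  shows "has_mono C V k"
proof (rule ccontr)
  assume nm: "\<not> has_mono C V k"
  have M0: "M > 0" using TM pos by simp
  \<comment> \<open>A difference of T / 4 would already gain (T / 4) ^ 2 / (8 * M) = T ^ 2 / (128 *
    M) in the exponent, at least \<open>S\<close>.\<close>
  have diag: "\<bar>real (k True) - real (k False)\<bar> < real T / 4"
  proof (rule ccontr)
    assume "\<not> ?thesis"
    then have "real (card V) < 2 ^ M * exp (- ((real T / 4)\<^sup>2 / (8 * real M)))"
      unfolding M by (intro ramsey_off_diagonal[OF V nm]) auto
    also have "\<dots> \<le> 2 ^ M * exp (- S)"
      using off_diag by (simp add: power_divide)
    finally show False using card_V by simp
  qed
  obtain j V' k' where j: "j \<le> J" and V': "V' \<subseteq> V" "\<not> has_mono C V' k'"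
    and k': "k' True + k' False + j = M" "\<And>i. k' i \<le> k i"
    and card_V'_ge: "(1 / 2 + \<epsilon>) ^ j * real (card V) \<le> real (card V')"
    and deg: "j = J \<or> (\<forall>x\<in>V'. \<forall>i. real (card (V' \<inter> nbrs C i x)) < (1 / 2 + \<epsilon>) * real (card V'))"
    using degree_regularisation[OF less_imp_le[OF \<epsilon>(1)] V nm, of J] unfolding M by blast
  have finV': "finite V'" using V V' finite_subset by blast
  have half: "2 ^ M * exp (- S) / 2 ^ j * (1 + 2 * \<epsilon>) ^ j \<le> real (card V')"
  proof -
    have "2 ^ M * exp (- S) / 2 ^ j * (1 + 2 * \<epsilon>) ^ j = ((1 + 2 * \<epsilon>) / 2) ^ j * (2 ^ M * exp (- S))"
      by (simp add: power_divide)
    also have "(1 + 2 * \<epsilon>) / 2 = 1 / 2 + \<epsilon>" by simp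
    also have "(1 / 2 + \<epsilon>) ^ j * (2 ^ M * exp (- S)) \<le> (1 / 2 + \<epsilon>) ^ j * real (card V)"
      using card_V \<epsilon> by (intro mult_left_mono) auto
    finally show ?thesis using card_V'_ge by linarith
  qed
  \<comment> \<open>After \<open>J\<close> moves the surplus (1 + 2 * \<epsilon>) ^ J recovers the
    factor exp (- S), so \<open>V'\<close> has at least 2 ^ (k' True + k' False) elements.\<close>
  have "j \<noteq> J"
  proof
    assume "j = J"
    have "2 ^ (k' True + k' False) = 2 ^ M * exp (- S) / 2 ^ J * exp S"
      using k'(1) \<open>j = J\<close> by (simp add: exp_minus power_add[symmetric] flip: k'(1)) (simp add: power_add)
    also have "\<dots> \<le> 2 ^ M * exp (- S) / 2 ^ J * (1 + 2 * \<epsilon>) ^ J"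
      using regular by (intro mult_left_mono) auto
    also have "\<dots> \<le> real (card V')" using half \<open>j = J\<close> by simp
    finally show False
      using ramsey_off_diagonal[OF finV' V'(2), of 0] by simp
  qed
  then have deg': "real (card (V' \<inter> nbrs C i x)) < (1 / 2 + \<epsilon>) * real (card V')" if "x \<in> V'" for x i
    using deg that by blast
  have V'_ge: "2 ^ M * exp (- S) / 2 ^ j \<le> real (card V')"
  proof -
    have "2 ^ M * exp (- S) / 2 ^ j * 1 \<le> 2 ^ M * exp (- S) / 2 ^ j * (1 + 2 * \<epsilon>) ^ j"
      using \<epsilon> by (intro mult_left_mono one_le_power) auto
    then show ?thesis using half by linarith
  qed
  have V'_ge_J: "2 ^ M * exp (- S) / 2 ^ J \<le> real (card V')"
  proof -
    have "2 ^ M * exp (- S) / 2 ^ J \<le> 2 ^ M * exp (- S) / (2 ^ j :: real)"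
      using j by (intro divide_left_mono power_increasing) auto
    then show ?thesis using V'_ge by linarith
  qed
  have eV': "1 \<le> \<epsilon> * real (card V')"
    using large V'_ge_J \<epsilon> by (smt (verit) mult_left_mono)
  \<comment> \<open>Reservoir and \<open>Y0\<close> are both \<open>V'\<close>. Upper degree bounds
    1/2 + \<epsilon> in both colours give lower bounds 1/2 - \<epsilon>, up to the vertex itself,
    which costs another \<epsilon>; hence p0 = 1/2 - 2 * \<epsilon>. The value a = 1 / (12 * T)
    satisfies the halving condition by Bernoulli's inequality.\<close>
  have "\<exists>i S W. S \<subseteq> V' \<and> finite S \<and> card S = T \<and> mono_clique C i S \<and> W \<subseteq> V'
      \<and> (\<forall>x\<in>S. W \<subseteq> nbrs C i x) \<and> (1 / 2 - 2 * \<epsilon> - \<epsilon>) ^ (T + B) * real (card V') \<le> real (card W)"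
  proof (rule book_theorem[of V' \<epsilon> "1 / 2 - 2 * \<epsilon>" "1 / (12 * real T)" T n0 B])
    show "V' \<noteq> {}" using eV' by auto
    have "1 + real T * - (6 * (1 / (12 * real T))) \<le> (1 + - (6 * (1 / (12 * real T)))) ^ T"
      using pos(1) by (intro Bernoulli_inequality) (auto simp: field_simps)
    then show "1 / 2 \<le> (1 - 6 * (1 / (12 * real T))) ^ T" using pos(1) by simp
    show "(4000 * exp (4 * real n0)) ^ (2 * T) * (1000 * exp (4 * sqrt (2 / (1 / (12 * real T) * \<epsilon>)))) ^ (2 * B)
        \<le> real (card V')"
      using reservoir V'_ge_J by simp
    fix i x assume x: "x \<in> V'"
    have "V' = insert x ((V' \<inter> nbrs C i x) \<union> (V' \<inter> nbrs C (\<not> i) x))"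
      using x nbrs_Un[of C x] by (cases i) auto
    then have "card V' \<le> Suc (card ((V' \<inter> nbrs C i x) \<union> (V' \<inter> nbrs C (\<not> i) x)))"
      by (metis card_insert_le_m1 diff_Suc_1 order_refl zero_less_Suc)
    also have "\<dots> \<le> Suc (card (V' \<inter> nbrs C i x) + card (V' \<inter> nbrs C (\<not> i) x))"
      by (simp add: card_Un_le)
    finally have "real (card V') \<le> 1 + real (card (V' \<inter> nbrs C i x)) + real (card (V' \<inter> nbrs C (\<not> i) x))"
      by linarith
    then have "(1 / 2 - 2 * \<epsilon>) * real (card V') \<le> real (card (V' \<inter> nbrs C i x))"
      using deg'[OF x, of "\<not> i"] eV' by (simp add: algebra_simps)
    then show "(1 / 2 - 2 * \<epsilon>) * real (card V') \<le> real (card (nbrs C i x \<inter> V'))"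
      by (simp add: Int_commute)
  qed (use finV' \<epsilon> pos boosts in \<open>auto simp: field_simps\<close>)
  then obtain i S' W where S': "S' \<subseteq> V'" "finite S'" "card S' = T" "mono_clique C i S'"
    and W: "W \<subseteq> V'" "\<And>x. x \<in> S' \<Longrightarrow> W \<subseteq> nbrs C i x"
      "(1 / 2 - 2 * \<epsilon> - \<epsilon>) ^ (T + B) * real (card V') \<le> real (card W)"
    by blast
  let ?k = "k'(i := k' i - T)"
  have k'_ge: "real (k l) \<le> real (k' l) + real j" for l
  proof -
    have "k l \<le> k' l + j"
      using k'(1) M k'(2)[of True] k'(2)[of False] by (cases l) simp_all
    then show ?thesis by linarith
  qed
  have jT: "real j \<le> real T / 4" using j JT by linarith
  have k'_T: "T \<le> k' i"
  proof -
    have "real M = real (k i) + real (k (\<not> i))" using M by (cases i) auto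
    moreover have "\<bar>real (k i) - real (k (\<not> i))\<bar> < real T / 4" using diag by (cases i) (auto simp: abs_minus_commute)
    ultimately show ?thesis using k'_ge[of i] jT TM by linarith
  qed
  have no_mono: "\<not> has_mono C W ?k"
    using has_mono_extend[OF S'(2,1,4) _ W(1,2)] S'(3) k'_T V'(2) by auto
  have sum_k: "?k True + ?k False + T + j = M" using k'(1) k'_T by (cases i) auto
  \<comment> \<open>The targets differed by less than T / 4, the moves changed this by at most T /
    4, and the clique now lowers one target by \<open>T\<close>.\<close>
  have gap: "real T / 2 \<le> \<bar>real (?k True) - real (?k False)\<bar>"
  proof -
    have "\<bar>real (k' True) - real (k' False)\<bar> \<le> real T / 4 + real j"
      using diag k'_ge[of True] k'_ge[of False] k'(2)[of True] k'(2)[of False] by linarith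
    then show ?thesis using jT k'_T by (cases i) (auto simp: of_nat_diff)
  qed
  have "finite W" using W(1) finV' by (rule finite_subset)
  then have "real (card W) < 2 ^ (?k True + ?k False) *
      exp (- ((real T / 2)\<^sup>2 / (8 * real (?k True + ?k False))))"
    by (rule ramsey_off_diagonal[OF _ no_mono _ gap]) simp
  also have "\<dots> \<le> 2 ^ (?k True + ?k False) * exp (- (real T ^ 2 / (32 * real M)))"
  proof -
    have "real (?k True + ?k False) \<le> real M" "real (?k True + ?k False) > 0"
      using sum_k pos(1) TM jT by linarith+
    then have "(real T / 2)\<^sup>2 / (8 * real M) \<le> (real T / 2)\<^sup>2 / (8 * real (?k True + ?k False))"
      by (intro divide_left_mono) auto
    then show ?thesis by (simp add: power_divide)
  qed
  also have "\<dots> \<le> 2 ^ (?k True + ?k False) * exp (- (S + 12 * \<epsilon> * real (T + B) + real B))"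
    using book by simp
  also have "\<dots> = 2 ^ (?k True + ?k False) * (exp (- 12 * \<epsilon>) ^ (T + B) * exp (- 1) ^ B * exp (- S))"
    by (simp add: exp_of_nat_mult[symmetric] mult_exp_exp algebra_simps)
  \<comment> \<open>Here (1 - 6 * \<epsilon>) / 2 is the book factor 1/2 - 3 * \<epsilon>. The extra
    (1 / 2) ^ B pays for boosts, which shrink the common neighbourhood without lengthening the
    clique.\<close>
  also have "\<dots> \<le> 2 ^ (?k True + ?k False) * ((1 - 6 * \<epsilon>) ^ (T + B) * (1 / 2) ^ B * exp (- S))"
  proof -
    have "- 12 * \<epsilon> \<le> ln (1 - 6 * \<epsilon>)"
    proof -
      have "2 * (6 * \<epsilon>)\<^sup>2 \<le> 6 * \<epsilon>"
        using mult_left_mono[of \<epsilon> "1 / 12" "72 * \<epsilon>"] \<epsilon> by (simp add: power2_eq_square)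
      then show ?thesis
        using ln_one_minus_pos_lower_bound[of "6 * \<epsilon>"] \<epsilon> by linarith
    qed
    then have "exp (- 12 * \<epsilon>) \<le> 1 - 6 * \<epsilon>" using \<epsilon> by (subst ln_ge_iff[symmetric]) auto
    moreover have "exp (- 1 :: real) \<le> 1 / 2"
      using exp_ge_add_one_self[of "1::real"] by (simp add: exp_minus field_simps)
    ultimately show ?thesis
      using \<epsilon> by (intro mult_left_mono mult_right_mono mult_mono power_mono) auto
  qed
  also have "\<dots> = ((1 - 6 * \<epsilon>) / 2) ^ (T + B) * (2 ^ M * exp (- S) / 2 ^ j)"
    by (simp add: power_divide power_add flip: sum_k)
  also have "(1 - 6 * \<epsilon>) / 2 = 1 / 2 - 2 * \<epsilon> - \<epsilon>" by simp
  also have "(1 / 2 - 2 * \<epsilon> - \<epsilon>) ^ (T + B) * (2 ^ M * exp (- S) / 2 ^ j)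
      \<le> (1 / 2 - 2 * \<epsilon> - \<epsilon>) ^ (T + B) * real (card V')"
    using V'_ge \<epsilon> by (intro mult_left_mono) auto
  finally show False using W(3) by simp
qed

text \<open>The clique size is \<open>M powr (2/3)\<close>, the degree slack is of order \<open>M powr (-1/3)\<close>, and the
  boost threshold and the number of boosts are \<open>M powr (1/4)\<close>.\<close>

lemma ramsey_improved:
  "eventually (\<lambda>M. \<forall>k V (C :: 'v set set). k True + k False = M \<longrightarrow> finite V \<longrightarrow>
      2 ^ M * exp (- (real M powr (1/4))) \<le> real (card V) \<longrightarrow> has_mono C V k) sequentially"
proof -
  \<comment> \<open>The hypotheses of \<open>ramsey_improved_conditional\<close> with rounding
    errors included. The reservoir costs are exponentials of order x powr (11/12) and x powr (3/4),
    below x; the boosts gain exp of order x powr (1/12), which beats 1 / \<epsilon>.\<close>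
  have "eventually (\<lambda>x::real. x \<ge> 1 \<and> x powr (1/4) \<le> x powr (1/3) / 128
      \<and> x powr (1/4) \<le> (x powr (2/3) / 4 - 1) * (x powr (-1/3) / 2000)
      \<and> x powr (1/4) + 12 * (x powr (-1/3) / 2000) * ((x powr (2/3) + 1) + (x powr (1/4) + 1))
           + (x powr (1/4) + 1) \<le> x powr (1/3) / 32
      \<and> x powr (-1/3) / 2000 / 2 * (1 + x powr (1/2) * (1 / (12 * (x powr (2/3) + 1)))) powr (x powr (1/4)) > 1
      \<and> 2 * (x powr (2/3) + 1) * (10 + 4 * (x powr (1/4) + 1)) + 2 * (x powr (1/4) + 1) *
           (8 + 4 * sqrt (24 * (x powr (2/3) + 1) / (x powr (-1/3) / 2000)))
         \<le> (x - (x powr (2/3) + 1)) / 2 - x powr (1/4)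
      \<and> 4 * x powr (2/3) + 4 \<le> x
      \<and> 1 \<le> x powr (-1/3) / 2000 * exp ((x - (x powr (2/3) + 1)) / 2 - x powr (1/4))) at_top"
    by (intro eventually_conj; real_asymp)
  then have "eventually (\<lambda>M. (\<lambda>x::real. x \<ge> 1 \<and> x powr (1/4) \<le> x powr (1/3) / 128
      \<and> x powr (1/4) \<le> (x powr (2/3) / 4 - 1) * (x powr (-1/3) / 2000)
      \<and> x powr (1/4) + 12 * (x powr (-1/3) / 2000) * ((x powr (2/3) + 1) + (x powr (1/4) + 1))
           + (x powr (1/4) + 1) \<le> x powr (1/3) / 32
      \<and> x powr (-1/3) / 2000 / 2 * (1 + x powr (1/2) * (1 / (12 * (x powr (2/3) + 1)))) powr (x powr (1/4)) > 1
      \<and> 2 * (x powr (2/3) + 1) * (10 + 4 * (x powr (1/4) + 1)) + 2 * (x powr (1/4) + 1) *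
           (8 + 4 * sqrt (24 * (x powr (2/3) + 1) / (x powr (-1/3) / 2000)))
         \<le> (x - (x powr (2/3) + 1)) / 2 - x powr (1/4)
      \<and> 4 * x powr (2/3) + 4 \<le> x
      \<and> 1 \<le> x powr (-1/3) / 2000 * exp ((x - (x powr (2/3) + 1)) / 2 - x powr (1/4))) (real M)) sequentially"
    by (rule eventually_compose_filterlim[OF _ filterlim_real_sequentially])
  then show ?thesis
  proof eventually_elim
    case (elim M)
    define x where "x = real M"
    define P where "P = x powr (2/3)"
    \<comment> \<open>The factor 2000 makes the leading term 12 * \<epsilon> * P = 3 / 500 * x powr
      (1/3) smaller than x powr (1/3) / 32.\<close>
    define \<epsilon> where "\<epsilon> = x powr (-1/3) / 2000"
    define S where "S = x powr (1/4)"
    define T where "T = nat \<lceil>P\<rceil>"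
    define B where "B = nat \<lceil>x powr (1/4)\<rceil>"
    define J where "J = T div 4"
    have asym: "x \<ge> 1" "S \<le> x powr (1/3) / 128" "S \<le> (P / 4 - 1) * \<epsilon>"
      "S + 12 * \<epsilon> * ((P + 1) + (S + 1)) + (S + 1) \<le> x powr (1/3) / 32"
      "\<epsilon> / 2 * (1 + x powr (1/2) * (1 / (12 * (P + 1)))) powr S > 1"
      "2 * (P + 1) * (10 + 4 * (S + 1)) + 2 * (S + 1) * (8 + 4 * sqrt (24 * (P + 1) / \<epsilon>))
         \<le> (x - (P + 1)) / 2 - S"
      "4 * P + 4 \<le> x"
      "1 \<le> \<epsilon> * exp ((x - (P + 1)) / 2 - S)"
      using elim unfolding x_def \<epsilon>_def S_def P_def by blast+
    have x_pos: "x > 0" using asym(1) by simp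
    then have P_pos: "P > 0" by (simp add: P_def)
    have T: "P \<le> real T" "real T \<le> P + 1"
      unfolding T_def using P_pos by (simp_all add: real_nat_ceiling_ge of_nat_ceiling)
    have B: "S \<le> real B" "real B \<le> S + 1"
      unfolding B_def S_def using x_pos by (simp_all add: real_nat_ceiling_ge of_nat_ceiling)
    have S1: "S \<ge> 1" unfolding S_def using asym(1) by (simp add: ge_one_powr_ge_zero)
    have T_pos: "T > 0" using T P_pos by linarith
    have B_pos: "B > 0" using B S1 by linarith
    have \<epsilon>: "0 < \<epsilon>" "\<epsilon> \<le> 1 / 12"
      using x_pos asym(1) powr_mono[of "-1/3" 0 x] by (auto simp: \<epsilon>_def)
    have TT: "x powr (1/3) \<le> real T ^ 2 / x"
    proof -
      have "x powr (1/3) * x = P ^ 2"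
        using x_pos powr_add[of x "1/3" 1] powr_add[of x "2/3" "2/3"] by (simp add: P_def power2_eq_square)
      also have "\<dots> \<le> real T ^ 2" using T P_pos by (intro power_mono) auto
      finally show ?thesis using x_pos by (simp add: pos_le_divide_eq)
    qed
    have BB: "x powr (1/2) \<le> real B ^ 2"
    proof -
      have "x powr (1/2) = S ^ 2"
        using x_pos powr_add[of x "1/4" "1/4"] by (simp add: S_def power2_eq_square)
      also have "\<dots> \<le> real B ^ 2" using B S1 by (intro power_mono) auto
      finally show ?thesis .
    qed
    have "T \<le> 4 * J + 3" "J \<le> T" unfolding J_def by linarith+
    then have "real T \<le> 4 * real J + 3" "real J \<le> real T" by linarith+
    then have J: "real J \<le> P + 1" "P / 4 - 1 \<le> real J"
      using T by linarith+
    \<comment> \<open>The crude bound 2 >= exp (1 / 2) suffices, since every quantity compared with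
      this has an exponent of lower order than x.\<close>
    have reservoir: "exp ((x - (P + 1)) / 2 - S) \<le> 2 ^ M * exp (- S) / 2 ^ J"
    proof -
      have "real J \<le> x" using J asym(7) P_pos by linarith
      then have JM: "J \<le> M" by (simp add: x_def)
      have e2: "exp (1 / 2 :: real) \<le> 2" 
        using exp_bound_half[of "1/2::real"] by simp
      have "exp ((x - (P + 1)) / 2 - S) \<le> exp (real (M - J) * (1 / 2)) * exp (- S)"
        using J JM by (simp add: x_def mult_exp_exp of_nat_diff)
      also have "\<dots> = exp (1 / 2) ^ (M - J) * exp (- S)" by (simp only: exp_of_nat_mult)
      also have "\<dots> \<le> 2 ^ (M - J) * exp (- S)" using e2 by (intro mult_right_mono power_mono) auto
      also have "\<dots> = 2 ^ M * exp (- S) / 2 ^ J" using JM by (simp add: power_diff)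
      finally show ?thesis .
    qed
    show ?case
    proof (intro allI impI)
      fix k and V :: "'v set" and C
      assume k: "k True + k False = M" and V: "finite V" "2 ^ M * exp (- (real M powr (1/4))) \<le> real (card V)"
      show "has_mono C V k"
      \<comment> \<open>The value \<open>B\<close> serves both as number of boosts and as boost
        threshold \<open>n0\<close>.\<close>
      proof (rule ramsey_improved_conditional[of V M k T B B S \<epsilon> J])
        show "2 ^ M * exp (- S) \<le> real (card V)" using V(2) by (simp add: S_def x_def)
        show "4 * J \<le> T" by (simp add: J_def)
        have "real (4 * T) \<le> real M" using T asym(7) unfolding x_def by simp
        then show "4 * T \<le> M" by linarith
        have "x powr (1/3) / 128 \<le> real T ^ 2 / x / 128" using TT by simp
        then show "S \<le> real T ^ 2 / (128 * real M)" using asym(2) by (simp add: x_def)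
        show "exp S \<le> (1 + 2 * \<epsilon>) ^ J"
        proof -
          have "(2 * \<epsilon>)\<^sup>2 \<le> \<epsilon>"
            using mult_left_mono[of \<epsilon> "1 / 12" "4 * \<epsilon>"] \<epsilon> by (simp add: power2_eq_square)
          then have "\<epsilon> \<le> ln (1 + 2 * \<epsilon>)"
            using ln_one_plus_pos_lower_bound[of "2 * \<epsilon>"] \<epsilon> by linarith
          then have e: "exp \<epsilon> \<le> 1 + 2 * \<epsilon>" using \<epsilon> by (subst ln_ge_iff[symmetric]) auto
          have "S \<le> real J * \<epsilon>"
            using asym(3) J(2) \<epsilon> by (smt (verit) mult_right_mono)
          then have "exp S \<le> exp \<epsilon> ^ J" by (simp add: exp_of_nat_mult[symmetric])
          also have "\<dots> \<le> (1 + 2 * \<epsilon>) ^ J" using e by (intro power_mono) auto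
          finally show ?thesis .
        qed
        show "S + 12 * \<epsilon> * real (T + B) + real B \<le> real T ^ 2 / (32 * real M)"
        proof -
          have "12 * \<epsilon> * real (T + B) \<le> 12 * \<epsilon> * ((P + 1) + (S + 1))"
            using T B \<epsilon> by (intro mult_left_mono) auto
          then have "S + 12 * \<epsilon> * real (T + B) + real B \<le> x powr (1/3) / 32"
            using asym(4) B by linarith
          also have "\<dots> \<le> real T ^ 2 / x / 32" using TT by simp
          finally show ?thesis by (simp add: x_def)
        qed
        show "1 < \<epsilon> / 2 * (1 + real B ^ 2 * (1 / (12 * real T))) ^ B"
        proof -
          let ?y = "x powr (1/2) * (1 / (12 * (P + 1)))"
          have y: "?y \<le> real B ^ 2 * (1 / (12 * real T))"
            using BB T T_pos P_pos by (intro mult_mono divide_left_mono) auto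
          have y0: "?y \<ge> 0" using P_pos by simp
          have "(1 + ?y) powr S \<le> (1 + ?y) powr real B" using B y0 by (intro powr_mono) auto
          also have "\<dots> = (1 + ?y) ^ B" using y0 by (intro powr_realpow) linarith
          also have "\<dots> \<le> (1 + real B ^ 2 * (1 / (12 * real T))) ^ B"
            using y y0 by (intro power_mono) auto
          finally have "\<epsilon> / 2 * (1 + ?y) powr S \<le> \<epsilon> / 2 * (1 + real B ^ 2 * (1 / (12 * real T))) ^ B"
            using \<epsilon> by (intro mult_left_mono) auto
          then show ?thesis using asym(5) by linarith
        qed
        show "(4000 * exp (4 * real B)) ^ (2 * T) * (1000 * exp (4 * sqrt (24 * real T / \<epsilon>))) ^ (2 * B)
            \<le> 2 ^ M * exp (- S) / 2 ^ J"
        proof -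
          have e: "exp (1::real) \<ge> 5 / 2"
            using exp_lower_Taylor_quadratic[of 1] by simp
          have "(4000::real) \<le> (5 / 2) ^ 10" by (simp add: power_divide)
          also have "\<dots> \<le> exp 1 ^ 10" using e by (intro power_mono) auto
          finally have e10: "4000 \<le> exp (10::real)" by (simp add: exp_of_nat_mult[symmetric])
          have "(1000::real) \<le> (5 / 2) ^ 8" by (simp add: power_divide)
          also have "\<dots> \<le> exp 1 ^ 8" using e by (intro power_mono) auto
          finally have e8: "1000 \<le> exp (8::real)" by (simp add: exp_of_nat_mult[symmetric])
          let ?n = "sqrt (24 * real T / \<epsilon>)"
          have "(4000 * exp (4 * real B)) ^ (2 * T) * (1000 * exp (4 * ?n)) ^ (2 * B)
             \<le> (exp 10 * exp (4 * real B)) ^ (2 * T) * (exp 8 * exp (4 * ?n)) ^ (2 * B)"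
            using e8 e10 by (intro mult_mono power_mono) auto
          also have "\<dots> = exp (real (2 * T) * (10 + 4 * real B) + real (2 * B) * (8 + 4 * ?n))"
            by (simp only: mult_exp_exp exp_of_nat_mult[symmetric])
          also have "\<dots> \<le> exp ((x - (P + 1)) / 2 - S)"
          proof -
            have "?n \<le> sqrt (24 * (P + 1) / \<epsilon>)"
              using T \<epsilon> by (intro real_sqrt_le_mono divide_right_mono) auto
            moreover have "?n \<ge> 0" using \<epsilon> by simp
            ultimately have "real (2 * T) * (10 + 4 * real B) + real (2 * B) * (8 + 4 * ?n)
                \<le> 2 * (P + 1) * (10 + 4 * (S + 1)) + 2 * (S + 1) * (8 + 4 * sqrt (24 * (P + 1) / \<epsilon>))"
              using T B S1 by (intro add_mono mult_mono) auto
            then show ?thesis using asym(6) by simp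
          qed
          also have "\<dots> \<le> 2 ^ M * exp (- S) / 2 ^ J" by (rule reservoir)
          finally show ?thesis .
        qed
        show "1 \<le> \<epsilon> * (2 ^ M * exp (- S) / 2 ^ J)"
          using asym(8) reservoir \<epsilon> by (smt (verit) mult_left_mono)
      qed (use V k T_pos B_pos S1 \<epsilon> in auto)
    qed
  qed
qed

section \<open>The on-line game\<close>

lemma builder_wins_if_mono_copy: "mono_copy G R B \<Longrightarrow> builder_wins G n R B"
  by (cases n) auto

lemma builder_wins_Suc: "builder_wins G n R B \<Longrightarrow> builder_wins G (Suc n) R B"
proof (induction n arbitrary: R B)
  case 0
  then show ?case using builder_wins_if_mono_copy[of G R B "Suc 0"] by (simp only: builder_wins.simps(1))
next
  case (Suc n)
  from Suc.prems consider "mono_copy G R B"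
    | e where "e \<in> [UNIV]\<^bsup>2\<^esup>" "e \<notin> R \<union> B" "builder_wins G n (insert e R) B" "builder_wins G n R (insert e B)"
    unfolding builder_wins.simps(2)[of G n] by blast
  then show ?case
  proof cases
    case 1
    then show ?thesis by (rule builder_wins_if_mono_copy)
  next
    case 2
    then show ?thesis
      unfolding builder_wins.simps(2)[of G "Suc n"] using Suc.IH by blast
  qed
qed

lemma builder_wins_mono:
  assumes "builder_wins G m R B" "m \<le> n"
  shows "builder_wins G n R B"
  using assms(2)
proof (induction rule: dec_induct)
  case base
  show ?case by (rule assms(1))
next
  case (step n)
  then show ?case by (intro builder_wins_Suc)
qed

text \<open>Fixing a batch \<open>S\<close> in advance reduces it to its final colouring, at a price
  of \<open>card S\<close> rounds, after which play goes on for \<open>n\<close> more.\<close>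

lemma builder_wins_by_drawing:
  assumes "finite S" "S \<subseteq> [UNIV]\<^bsup>2\<^esup>" "S \<inter> (R \<union> B) = {}"
    and "\<And>X Y. X \<union> Y = S \<Longrightarrow> builder_wins G n (X \<union> R) (Y \<union> B)"
  shows "builder_wins G (card S + n) R B"
  using assms
proof (induction S arbitrary: R B rule: finite_induct)
  case empty
  then show ?case using empty.prems(3)[of "{}" "{}"] by simp
next
  case (insert e S)
  have "builder_wins G (card S + n) (insert e R) B"
  proof (rule insert.IH)
    fix X Y assume "X \<union> Y = S"
    then show "builder_wins G n (X \<union> insert e R) (Y \<union> B)"
      using insert.prems(3)[of "insert e X" Y] by simp
  qed (use insert.hyps insert.prems(1,2) in auto)
  moreover have "builder_wins G (card S + n) R (insert e B)"
  proof (rule insert.IH)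
    fix X Y assume "X \<union> Y = S"
    then show "builder_wins G n (X \<union> R) (Y \<union> insert e B)"
      using insert.prems(3)[of X "insert e Y"] by simp
  qed (use insert.hyps insert.prems(1,2) in auto)
  moreover have "e \<in> [UNIV]\<^bsup>2\<^esup>" "e \<notin> R \<union> B"
    using insert.prems(1,2) by auto
  ultimately show ?case
    unfolding card_insert_disjoint[OF insert.hyps(1,2)] add_Suc builder_wins.simps by blast
qed

lemma mono_copy_complete_graph:
  assumes "finite K" "card K = t" "clique K (if i then R else B)"
  shows "mono_copy (complete_graph t) R B"
proof -
  have "contains_copy (if i then R else B) (complete_graph t)"
    using assms by (intro contains_copy_if_clique[of _ K])
      (auto simp: complete_graph_def simple_graph_def)
  then show ?thesis by (cases i) (auto simp: mono_copy_def)
qed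

lemma clique_Un:
  assumes "clique S C" "clique K C" "\<And>x v. x \<in> S \<Longrightarrow> v \<in> K \<Longrightarrow> {x, v} \<in> C"
  shows "clique (S \<union> K) C"
  using assms unfolding clique_def by (metis Un_iff insert_commute)

lemma card_nsets_2_le:
  assumes "finite V"
  shows "card ([V]\<^bsup>2\<^esup>) \<le> card V * card V"
proof -
  have "[V]\<^bsup>2\<^esup> \<subseteq> (\<lambda>(x, y). {x, y}) ` (V \<times> V)"
    by (auto simp: nsets_2_eq)
  then have "card ([V]\<^bsup>2\<^esup>) \<le> card (V \<times> V)"
    using assms by (intro surj_card_le) auto
  then show ?thesis by (simp add: card_cartesian_product)
qed

text \<open>Invariant: \<open>S i\<close> is a clique of colour \<open>i\<close> lacking
  \<open>k i\<close> vertices and joined to all of \<open>V\<close> in that colour, while no edge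
  inside \<open>V\<close> is drawn. A star in \<open>V\<close> leaves half of \<open>V\<close> in
  one colour and costs half of the term 2 ^ (s + 1) * N of the budget; at s = 0 all pairs of
  \<open>V\<close> are drawn, at most N * N.\<close>

lemma builder_wins_complete_graph:
  fixes V :: "nat set" and k :: "bool \<Rightarrow> nat"
  assumes "finite V" "card V = 2 ^ s * N" "N > 0" "[V]\<^bsup>2\<^esup> \<inter> (R \<union> B) = {}"
    and "\<And>k' (V' :: nat set) C. k' True + k' False + s = k True + k False \<Longrightarrow> finite V' \<Longrightarrow> card V' = N
           \<Longrightarrow> has_mono C V' k'"
    and "\<And>i. finite (S i)" "\<And>i. card (S i) + k i = t" "\<And>i. clique (S i) (if i then R else B)"
    and "\<And>i x v. x \<in> S i \<Longrightarrow> v \<in> V \<Longrightarrow> x \<noteq> v \<and> {x, v} \<in> (if i then R else B)"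
  shows "builder_wins (complete_graph t) (2 ^ (s + 1) * N + N * N) R B"
  using assms
proof (induction s arbitrary: V R B S k)
  case 0
  note ramsey = "0.prems"(5) and S = "0.prems"(6-9)
  have "builder_wins (complete_graph t) (card ([V]\<^bsup>2\<^esup>) + 0) R B"
  proof (rule builder_wins_by_drawing)
    show "finite ([V]\<^bsup>2\<^esup>)" by (rule finite_imp_finite_nsets[OF "0.prems"(1)])
    show "[V]\<^bsup>2\<^esup> \<subseteq> [UNIV]\<^bsup>2\<^esup>" by (rule nsets_mono) auto
    fix X Y assume XY: "X \<union> Y = [V]\<^bsup>2\<^esup>"
    \<comment> \<open>All pairs in \<open>V\<close> are now drawn, so the red set \<open>X\<close>
      encodes the colouring: a pair of \<open>K\<close> outside \<open>X\<close> lies in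
      \<open>Y\<close>.\<close>
    obtain i K where K: "K \<subseteq> V" "finite K" "card K = k i" "mono_clique X i K"
      using ramsey[of k V X] "0.prems"(1,2) unfolding has_mono_def by auto
    let ?C = "if i then X \<union> R else Y \<union> B"
    have "{x, y} \<in> (if i then X else Y)" if "x \<in> K" "y \<in> K" "x \<noteq> y" for x y
    proof -
      have "{x, y} \<in> X \<union> Y" using K(1) that unfolding XY nsets_2_eq by blast
      moreover have "y \<in> nbrs X i x"
        using K(4) that by (auto simp: mono_clique_def)
      then have "({x, y} \<in> X) = i" by (simp add: nbrs_def)
      ultimately show ?thesis by auto
    qed
    then have "clique K ?C" by (auto simp: clique_def)
    moreover have "clique (S i) ?C" using S(3)[of i] by (auto simp: clique_def split: if_splits)
    moreover have Sv: "x \<noteq> v \<and> {x, v} \<in> ?C" if "x \<in> S i" "v \<in> K" for x v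
      using S(4)[of x i v] that K(1) by (auto split: if_splits)
    ultimately have "clique (S i \<union> K) ?C" by (intro clique_Un) auto
    moreover have "S i \<inter> K = {}" using Sv by blast
    then have "card (S i \<union> K) = t" using S(1,2)[of i] K(2,3) by (simp add: card_Un_disjoint)
    ultimately show "builder_wins (complete_graph t) 0 (X \<union> R) (Y \<union> B)"
      using mono_copy_complete_graph[of "S i \<union> K" t i] S(1)[of i] K(2) by simp
  qed (use "0.prems" in auto)
  moreover have "card ([V]\<^bsup>2\<^esup>) + 0 \<le> 2 ^ (0 + 1) * N + N * N"
    using card_nsets_2_le[OF "0.prems"(1)] "0.prems"(2) by simp
  ultimately show ?case by (rule builder_wins_mono)
next
  case (Suc s)
  note finV = Suc.prems(1) and cardV = Suc.prems(2) and N = Suc.prems(3) and fresh = Suc.prems(4)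
    and ramsey = Suc.prems(5) and S = Suc.prems(6-9)
  show ?case
  proof (cases "\<exists>i. k i = 0")
    case True
    then obtain i where "k i = 0" by blast
    then have "mono_copy (complete_graph t) R B"
      using mono_copy_complete_graph[of "S i" t i R B] S(1-3)[of i] by simp
    then show ?thesis by (rule builder_wins_if_mono_copy)
  next
    case False
    obtain x where x: "x \<in> V" using cardV N by fastforce
    let ?E = "(\<lambda>v. {x, v}) ` (V - {x})"
    have E_sub: "?E \<subseteq> [V]\<^bsup>2\<^esup>" using x by (auto simp: nsets_2_eq)
    have "builder_wins (complete_graph t) (card ?E + (2 ^ (s + 1) * N + N * N)) R B"
    proof (rule builder_wins_by_drawing)
      show "finite ?E" using finV by simp
      show "?E \<subseteq> [UNIV]\<^bsup>2\<^esup>" using E_sub nsets_mono[of V UNIV 2] by auto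
      show "?E \<inter> (R \<union> B) = {}" using E_sub fresh by blast
      fix X Y assume XY: "X \<union> Y = ?E"
      define Z where "Z = (\<lambda>i. if i then X else Y)"
      define U where "U = (\<lambda>i. {v \<in> V - {x}. {x, v} \<in> Z i})"
      have "V - {x} \<subseteq> U True \<union> U False" using XY by (auto simp: U_def Z_def)
      then have "card (V - {x}) \<le> card (U True \<union> U False)"
        using finV by (intro card_mono) (auto simp: U_def)
      also have "\<dots> \<le> card (U True) + card (U False)" by (rule card_Un_le)
      \<comment> \<open>Losing \<open>x\<close> is harmless: two classes of fewer than 2 ^ s * N
        vertices would have at most 2 * (2 ^ s * N) - 2 in total.\<close>
      finally have "2 * (2 ^ s * N) - 1 \<le> card (U True) + card (U False)"
        using x finV cardV by simp
      then have "2 ^ s * N \<le> card (U True) \<or> 2 ^ s * N \<le> card (U False)" by linarith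
      then obtain i where "2 ^ s * N \<le> card (U i)" by blast
      then obtain V' where V': "V' \<subseteq> U i" "card V' = 2 ^ s * N"
        using obtain_subset_with_card_n by metis
      have V'V: "V' \<subseteq> V" "x \<notin> V'" and xV': "\<And>v. v \<in> V' \<Longrightarrow> {x, v} \<in> Z i"
        using V'(1) by (auto simp: U_def)
      let ?k = "k(i := k i - 1)" and ?S = "S(i := insert x (S i))"
      have xS: "x \<notin> S i" using S(4)[of x i x] x by blast
      have k0: "k i > 0" using False by (simp add: neq0_conv[symmetric] del: neq0_conv)
      show "builder_wins (complete_graph t) (2 ^ (s + 1) * N + N * N) (X \<union> R) (Y \<union> B)"
      proof (rule Suc.IH[of V' "X \<union> R" "Y \<union> B" ?k ?S])
        show "finite V'" using V'V finV finite_subset by blast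
        show "[V']\<^bsup>2\<^esup> \<inter> (X \<union> R \<union> (Y \<union> B)) = {}"
        proof -
          have "[V']\<^bsup>2\<^esup> \<inter> (X \<union> Y) = {}" unfolding XY using V'V(2) by (auto simp: nsets_def)
          moreover have "[V']\<^bsup>2\<^esup> \<inter> (R \<union> B) = {}"
            using fresh nsets_mono[OF V'V(1), of 2] by (meson disjoint_iff subsetD)
          ultimately show ?thesis by (simp only: Int_Un_distrib Un_empty)
        qed
        show "has_mono C W k'" if "k' True + k' False + s = ?k True + ?k False" "finite W" "card W = N"
          for k' and W :: "nat set" and C
        proof (rule ramsey[OF _ that(2,3)])
          show "k' True + k' False + Suc s = k True + k False"
            using that(1) k0 by (cases i) auto
        qed
        show "finite (?S j)" for j using S(1) by simp
        show "card (?S j) + ?k j = t" for j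
          using S(1)[of i] S(2)[of i] S(2)[of j] xS k0 by auto
        have ZE: "Z j \<union> (if j then R else B) = (if j then X \<union> R else Y \<union> B)" for j
          by (simp add: Z_def)
        show "clique (?S j) (if j then X \<union> R else Y \<union> B)" for j
        proof -
          have "{x, v} \<in> (if i then R else B)" if "v \<in> S i" for v
            using S(4)[OF that x] by (simp add: insert_commute)
          then show ?thesis
            using S(3)[of j] unfolding ZE[symmetric] clique_def by (auto simp: insert_commute)
        qed
        show "y \<noteq> v \<and> {y, v} \<in> (if j then X \<union> R else Y \<union> B)" if "y \<in> ?S j" "v \<in> V'" for j y v
        proof (cases "j = i \<and> y = x")
          case True
          then show ?thesis using xV'[OF that(2)] V'V(2) that(2) unfolding ZE[symmetric] by auto
        next
          case False
          then have "y \<in> S j" using that(1) by (auto split: if_splits)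
          then show ?thesis using S(4)[of y j v] that(2) V'V(1) unfolding ZE[symmetric] by blast
        qed
      qed (use V' N in auto)
    qed
    moreover have "card ?E + (2 ^ (s + 1) * N + N * N) \<le> 2 ^ (Suc s + 1) * N + N * N"
    proof -
      have "card ?E \<le> card (V - {x})" using finV by (intro card_image_le) auto
      also have "\<dots> \<le> 2 ^ Suc s * N" using x finV cardV by simp
      finally show ?thesis by (simp add: mult_ac)
    qed
    ultimately show ?thesis by (rule builder_wins_mono)
  qed
qed

section \<open>Bounds for the on-line Ramsey number of complete graphs\<close>

lemma online_ramsey_le:
  assumes "N > 0"
    and "\<And>k (V :: nat set) C. k True + k False + s = 2 * t \<Longrightarrow> finite V \<Longrightarrow> card V = N \<Longrightarrow> has_mono C V k"
  shows "online_ramsey (complete_graph t) \<le> 2 ^ (s + 1) * N + N * N"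
proof -
  have "builder_wins (complete_graph t) (2 ^ (s + 1) * N + N * N) {} {}"
    by (rule builder_wins_complete_graph[of "{..<2 ^ s * N}" _ _ _ _ "\<lambda>_. t" "\<lambda>_. {}"])
      (use assms in \<open>auto simp: clique_def mult_2\<close>)
  then show ?thesis unfolding online_ramsey_def by (rule Least_le)
qed

text \<open>Playing stars until the targets sum to 2 leaves a trivial Ramsey problem: one vertex
  suffices when both targets are 1, and otherwise one target is 0. A constant below 1 is the point,
  as it settles the small \<open>t\<close> in the theorem.\<close>

lemma online_ramsey_less:
  assumes "t \<ge> 2"
  shows "real (online_ramsey (complete_graph t)) \<le> 3 / 4 * 4 ^ t"
proof -
  have "online_ramsey (complete_graph t) \<le> 2 ^ (2 * t - 2 + 1) * 1 + 1 * 1"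
  proof (rule online_ramsey_le)
    fix k :: "bool \<Rightarrow> nat" and V :: "nat set" and C
    assume k: "k True + k False + (2 * t - 2) = 2 * t" and V: "card V = 1"
    show "has_mono C V k"
    proof (cases "k True = 1")
      case True
      then show ?thesis
        unfolding has_mono_def mono_clique_def using V
        by (intro exI[of _ True] exI[of _ V]) (auto simp: card_1_singleton_iff)
    next
      case False
      then have "k True = 0 \<or> k False = 0" using k assms by linarith
      then show ?thesis using has_mono_zero by blast
    qed
  qed simp
  also have "2 * t - 2 + 1 = 2 * (t - 1) + 1" using assms by simp
  finally have "real (online_ramsey (complete_graph t)) \<le> real (2 ^ (2 * (t - 1) + 1) + 1)"
    by (simp only: of_nat_le_iff mult_1_right)
  also have "\<dots> = 4 ^ t / 2 + 1"
    using assms by (cases t) (auto simp: power_mult)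
  also have "\<dots> \<le> 3 / 4 * 4 ^ t"
    using power_increasing[of 1 t "4::real"] assms by simp
  finally show ?thesis .
qed

text \<open>Stopping after \<open>t\<close> of the 2 * t steps makes both costs, 2 ^ (t + 1) * N and
  N * N, at most of order 4 ^ t * exp (- (t powr (1/4))) for the \<open>N\<close> supplied by
  \<open>ramsey_improved\<close>.\<close>

lemma online_ramsey_eventually:
  "eventually (\<lambda>t. real (online_ramsey (complete_graph t)) \<le> 8 * exp (- (real t powr (1/4))) * 4 ^ t) sequentially"
proof -
  have "eventually (\<lambda>t. 1 \<le> 2 ^ t * exp (- (real t powr (1/4)))) sequentially"
    by real_asymp
  with ramsey_improved[where 'v = nat] show ?thesis
  proof eventually_elim
    case (elim t)
    define e where "e = exp (- (real t powr (1/4)))"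
    \<comment> \<open>Rounding up at most doubles a number that is at least 1, hence the constant 8
      = 4 + 4.\<close>
    define N where "N = nat \<lceil>2 ^ t * e\<rceil>"
    have e: "0 < e" "e \<le> 1" "1 \<le> 2 ^ t * e" using elim(2) by (auto simp: e_def)
    have N: "2 ^ t * e \<le> real N" "real N \<le> 2 * (2 ^ t * e)"
      using e(3) unfolding N_def by linarith+
    have "N > 0" using N(1) e(3) by linarith
    then have "online_ramsey (complete_graph t) \<le> 2 ^ (t + 1) * N + N * N"
      by (rule online_ramsey_le) (use elim(1) N(1) in \<open>auto simp: e_def\<close>)
    then have "real (online_ramsey (complete_graph t)) \<le> real (2 ^ (t + 1) * N + N * N)"
      by (simp only: of_nat_le_iff)
    also have "\<dots> = 2 * 2 ^ t * real N + real N * real N" by simp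
    also have "\<dots> \<le> 2 * 2 ^ t * (2 * (2 ^ t * e)) + (2 * (2 ^ t * e)) * (2 * (2 ^ t * 1))"
      using N e by (intro add_mono mult_mono order_trans[OF N(2)]) auto
    also have "\<dots> = 8 * e * (2 ^ t * 2 ^ t)" by simp
    also have "2 ^ t * 2 ^ t = (4 :: real) ^ t" by (simp flip: power_mult_distrib)
    finally show ?case by (simp add: e_def)
  qed
qed

theorem theorem7:
  shows "\<exists>c::real. c > 0 \<and>
    (\<forall>t::nat. t \<ge> 3 \<longrightarrow>
      real (online_ramsey (complete_graph t))
        \<le> real t powr (- c * (ln (real t) / ln (ln (real t)))) * 4 ^ t)"
proof -
  let ?L = "\<lambda>t::nat. ln (real t) / ln (ln (real t))"
  \<comment> \<open>The target is exp (- (ln t) ^ 2 / ln (ln t)), whose exponent is only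
    polylogarithmic, so t powr (1/4) wins.\<close>
  have "eventually (\<lambda>t::nat. 8 * exp (- (real t powr (1/4))) \<le> real t powr (- ?L t)) sequentially"
    by real_asymp
  with online_ramsey_eventually have "eventually (\<lambda>t. real (online_ramsey (complete_graph t)) \<le>
      8 * exp (- (real t powr (1/4))) * 4 ^ t \<and> 8 * exp (- (real t powr (1/4))) \<le> real t powr (- ?L t)) sequentially"
    by (rule eventually_conj)
  then obtain t0 where t0: "\<And>t. t \<ge> t0 \<Longrightarrow> real (online_ramsey (complete_graph t)) \<le>
      8 * exp (- (real t powr (1/4))) * 4 ^ t \<and> 8 * exp (- (real t powr (1/4))) \<le> real t powr (- ?L t)"
    unfolding eventually_sequentially by blast
  \<comment> \<open>Nonnegativity ensures that lowering c below 1 only weakens the bound for large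
    \<open>t\<close>.\<close>
  have L: "?L t \<ge> 0" if "t \<ge> 3" for t
  proof -
    have "exp 1 \<le> real t" using exp_le that by linarith
    then have "1 \<le> ln (real t)" using that by (subst ln_ge_iff) auto
    then show ?thesis by simp
  qed
  \<comment> \<open>As c tends to 0 from above the factor tends to 1, so one c works for the
    finitely many \<open>t\<close> below \<open>t0\<close>.\<close>
  have small: "eventually (\<lambda>c::real. 3 / 4 < real t powr (- c * ?L t)) (at_right 0)" if "t \<ge> 3" for t
  proof (rule order_tendstoD(1))
    show "((\<lambda>c. real t powr (- c * ?L t)) \<longlongrightarrow> real t powr (- 0 * ?L t)) (at_right 0)"
      using that by (intro tendsto_intros) auto
    show "3 / 4 < real t powr (- 0 * ?L t)" using that by simp
  qed
  have "eventually (\<lambda>c::real. \<forall>t\<in>{3..<t0}. 3 / 4 < real t powr (- c * ?L t)) (at_right 0)"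
    using small by (intro eventually_ball_finite) auto
  moreover have "eventually (\<lambda>c::real. c \<in> {0<..<1}) (at_right 0)"
    by (rule eventually_at_right_real) simp
  ultimately have "eventually (\<lambda>c::real. (\<forall>t\<in>{3..<t0}. 3 / 4 < real t powr (- c * ?L t)) \<and> c \<in> {0<..<1}) (at_right 0)"
    by (rule eventually_conj)
  then obtain c where c: "\<And>t. t \<in> {3..<t0} \<Longrightarrow> 3 / 4 < real t powr (- c * ?L t)" "0 < c" "c < 1"
    using eventually_happens[of _ "at_right (0::real)"] by force
  have "real (online_ramsey (complete_graph t)) \<le> real t powr (- c * ?L t) * 4 ^ t" if t: "t \<ge> 3" for t
  proof (cases "t < t0")
    case True
    have "real (online_ramsey (complete_graph t)) \<le> 3 / 4 * 4 ^ t"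
      using t by (intro online_ramsey_less) simp
    also have "\<dots> \<le> real t powr (- c * ?L t) * 4 ^ t"
      using c(1)[of t] t True by (intro mult_right_mono) auto
    finally show ?thesis .
  next
    case False
    have "real (online_ramsey (complete_graph t)) \<le> real t powr (- ?L t) * 4 ^ t"
      using t0[of t] False by (smt (verit) mult_right_mono not_le zero_le_power)
    also have "\<dots> \<le> real t powr (- c * ?L t) * 4 ^ t"
    proof (intro mult_right_mono powr_mono)
      show "- ?L t \<le> - c * ?L t"
        using mult_right_mono[of c 1 "?L t"] c(3) L[OF t] by simp
    qed (use t in auto)
    finally show ?thesis .
  qed
  then show ?thesis using c(2) by blast
qed

end
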